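(* Let $G$ be a finite group and $R$ a faithful complex representation of $G$ of dimension $d$ whose image acts freely and satisfies $R(G)\subset SU(d)$. Then for $1\le i,j\le n$ the entries of the inverse of the Euclidean Cartan matrix $\widetilde M[R](1)$ of $R$ are $$(\widetilde M[R](1)^{-1})^i_j=\frac{(-1)^dd_id_j}{2|G|}\left(\eta^0_0-\frac{\eta^i_0}{d_i}-\frac{\eta^0_j}{d_j}+\frac{\eta^i_j}{d_id_j}\right),$$ where $\eta^i_j$ are the generalized $\eta$-invariants.
   Context: The image of $R$ acts freely means: only the identity of the matrix group $R(G)$ has nonzero fixed vectors. $R_0$ (trivial), $R_1,\dots,R_n$ are the irreducible complex representations of the finite group $G$ up to isomorphism, with characters $\chi_0,\dots,\chi_n$, $d_i=\dim R_i$; $C_0,\dots,C_n$ are the conjugacy classes of $G$, $g_k\in C_k$ is a representative, $g_0$ is the identity. $E$ is the identity matrix. With $(R,Q)=\frac1{|G|}\sum_{g\in G}\chi^R(g)\overline{\chi^Q(g)}$ ($\chi^R$ the character of $R$), the Clebsch–Gordan matrix $M[Q]$ of a representation $Q$ is the matrix with entries $M[Q]^i_j=(Q\otimes R_i,R_j)$ (row $i$, column $j$), $0\le i,j\le n$. Let $R_A^m$ be the $m$-th exterior power of $R$ and $M[R_A(-q)]=\sum_m(-q)^mM[R_A^m]$. The matrix $\widetilde M[R](q)$ is obtained from $M[R_A(-q)]$ by deleting the row and column with index $0$; the Euclidean Cartan matrix of $R$ is $\widetilde M[R](1)$ (it is invertible when the image of $R$ acts freely). For each irreducible representation $R_j$,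 $\eta^0_j$ denotes the Atiyah–Patodi–Singer $\eta$-invariant (of $S^{2d-1}/G$, associated with $R_j$); when $R(G)\subset SU(d)$ it is given by the known formula $$\eta^0_j=\frac{(-1)^d2}{|G|}\sum_{k:\ \det (E-R(g_k))\neq 0}\frac{|C_k|\overline{\chi_j(g_k)}}{\det (E-R(g_k))},$$ which may be taken as the definition here. The generalized $\eta$-invariants are $\eta^i_j=\sum_{k=0}^n(R_i\otimes R_k,R_j)\,\eta^0_k$, $0\le i,j\le n$.
   Formalization: The prefactor is corrected from (-1)^d d_i d_j/(2|G|) to (-1)^d d_i d_j/2, since the eta-invariants already contain 1/|G|; as printed it fails for Z/2 acting by -E on C^2 (inverse entry 1/2, printed formula gives 1/4). *)

theory Defs
  imports
    Complex_Main
    "HOL-Algebra.Group_Action"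
    "Jordan_Normal_Form.VS_Connect"
    "Jordan_Normal_Form.Schur_Decomposition"
begin

section \<open>Complex matrix representations\<close>

definition GL :: "nat \<Rightarrow> complex mat monoid" where
  "GL d = units_of (ring_mat TYPE(complex) d ())"

definition SU :: "nat \<Rightarrow> complex mat set" where
  "SU d = {A \<in> carrier_mat d d. mat_adjoint A * A = 1\<^sub>m d \<and> det A = 1}"

definition representation ::
  "('a, 'b) monoid_scheme \<Rightarrow> nat \<Rightarrow> ('a \<Rightarrow> complex mat) \<Rightarrow> bool" where
  "representation G d \<rho> \<longleftrightarrow> \<rho> \<in> hom G (GL d)"

definition faithful :: "('a, 'b) monoid_scheme \<Rightarrow> ('a \<Rightarrow> complex mat) \<Rightarrow> bool" where
  "faithful G \<rho> \<longleftrightarrow> inj_on \<rho> (carrier G)"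

definition irreducible_rep ::
  "('a, 'b) monoid_scheme \<Rightarrow> nat \<Rightarrow> ('a \<Rightarrow> complex mat) \<Rightarrow> bool" where
  "irreducible_rep G d \<rho> \<longleftrightarrow> representation G d \<rho> \<and> d > 0 \<and>
     (\<forall>W. VectorSpace.subspace class_ring W (module_vec TYPE(complex) d) \<and>
          (\<forall>g\<in>carrier G. \<forall>v\<in>W. \<rho> g *\<^sub>v v \<in> W)
        \<longrightarrow> W = {0\<^sub>v d} \<or> W = carrier_vec d)"

definition equivalent_reps ::
  "('a, 'b) monoid_scheme \<Rightarrow> nat \<Rightarrow> ('a \<Rightarrow> complex mat) \<Rightarrow> nat \<Rightarrow> ('a \<Rightarrow> complex mat) \<Rightarrow> bool" where
  "equivalent_reps G d \<rho> e \<sigma> \<longleftrightarrow>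
     d = e \<and> (\<exists>P\<in>carrier (GL d). \<forall>g\<in>carrier G. P * \<rho> g = \<sigma> g * P)"

definition irreps_up_to_iso ::
  "('a, 'b) monoid_scheme \<Rightarrow> nat \<Rightarrow> (nat \<Rightarrow> nat) \<Rightarrow> (nat \<Rightarrow> 'a \<Rightarrow> complex mat) \<Rightarrow> bool" where
  "irreps_up_to_iso G n dm Rs \<longleftrightarrow>
     (\<forall>i\<le>n. irreducible_rep G (dm i) (Rs i)) \<and>
     (\<forall>i\<le>n. \<forall>j\<le>n. equivalent_reps G (dm i) (Rs i) (dm j) (Rs j) \<longrightarrow> i = j) \<and>
     (\<forall>e \<sigma>. irreducible_rep G e \<sigma> \<longrightarrow> (\<exists>i\<le>n. equivalent_reps G e \<sigma> (dm i) (Rs i))) \<and>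
     dm 0 = 1 \<and> (\<forall>g\<in>carrier G. Rs 0 g = 1\<^sub>m 1)"

definition acts_freely ::
  "('a, 'b) monoid_scheme \<Rightarrow> nat \<Rightarrow> ('a \<Rightarrow> complex mat) \<Rightarrow> bool" where
  "acts_freely G d \<rho> \<longleftrightarrow>
     (\<forall>A\<in>\<rho> ` carrier G. (\<exists>v\<in>carrier_vec d. v \<noteq> 0\<^sub>v d \<and> A *\<^sub>v v = v) \<longrightarrow> A = 1\<^sub>m d)"

definition conj_classes :: "('a, 'b) monoid_scheme \<Rightarrow> 'a set set" where
  "conj_classes G = orbits G (carrier G)
     (\<lambda>g. \<lambda>h\<in>carrier G. g \<otimes>\<^bsub>G\<^esub> h \<otimes>\<^bsub>G\<^esub> inv\<^bsub>G\<^esub> g)"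


section \<open>Characters and operations on representations\<close>

definition mat_trace :: "complex mat \<Rightarrow> complex" where
  "mat_trace A = (\<Sum>i<dim_row A. A $$ (i, i))"

definition rep_char :: "('a \<Rightarrow> complex mat) \<Rightarrow> 'a \<Rightarrow> complex" where
  "rep_char \<rho> g = mat_trace (\<rho> g)"

definition rep_inner ::
  "('a, 'b) monoid_scheme \<Rightarrow> ('a \<Rightarrow> complex mat) \<Rightarrow> ('a \<Rightarrow> complex mat) \<Rightarrow> complex" where
  "rep_inner G \<rho> \<sigma> =
     1 / of_nat (Coset.order G) * (\<Sum>g\<in>carrier G. rep_char \<rho> g * cnj (rep_char \<sigma> g))"

definition kronecker :: "complex mat \<Rightarrow> complex mat \<Rightarrow> complex mat" where
  "kronecker A B = mat (dim_row A * dim_row B) (dim_col A * dim_col B)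
     (\<lambda>(i, j). A $$ (i div dim_row B, j div dim_col B) * B $$ (i mod dim_row B, j mod dim_col B))"

definition tensor_rep ::
  "('a \<Rightarrow> complex mat) \<Rightarrow> ('a \<Rightarrow> complex mat) \<Rightarrow> 'a \<Rightarrow> complex mat" where
  "tensor_rep \<rho> \<sigma> g = kronecker (\<rho> g) (\<sigma> g)"

text \<open>
  The vectors \<open>e\<^sub>J = e\<^bsub>j1\<^esub> \<and> \<dots> \<and> e\<^bsub>jm\<^esub>\<close> with \<open>j1 < \<dots> < jm\<close> form a basis of the \<open>m\<close>-th
  exterior power of the \<open>d\<close>-dimensional space, and the map induced by \<open>A\<close> sends \<open>e\<^sub>J\<close> to the sum
  over \<open>I\<close> of the minor of \<open>A\<close> with rows \<open>I\<close> and columns \<open>J\<close> times \<open>e\<^sub>I\<close>. The list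
  \<open>increasing_lists d m\<close> enumerates the index lists of this basis; for \<open>m = 0\<close> it is \<open>[[]]\<close>,
  which gives the trivial representation, and for \<open>m > d\<close> it is empty.
\<close>

definition increasing_lists :: "nat \<Rightarrow> nat \<Rightarrow> nat list list" where
  "increasing_lists d m = filter (\<lambda>I. length I = m) (subseqs [0..<d])"

definition exterior_power_mat :: "nat \<Rightarrow> complex mat \<Rightarrow> complex mat" where
  "exterior_power_mat m A =
     (let S = increasing_lists (dim_row A) m in
      mat (length S) (length S)
        (\<lambda>(a, b). det (mat m m (\<lambda>(i, j). A $$ (S ! a ! i, S ! b ! j)))))"

definition exterior_power_rep :: "nat \<Rightarrow> ('a \<Rightarrow> complex mat) \<Rightarrow> 'a \<Rightarrow> complex mat" where
  "exterior_power_rep m \<rho> g = exterior_power_mat m (\<rho> g)"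


section \<open>Clebsch--Gordan matrices and the Euclidean Cartan matrix\<close>

definition clebsch_gordan ::
  "('a, 'b) monoid_scheme \<Rightarrow> nat \<Rightarrow> (nat \<Rightarrow> 'a \<Rightarrow> complex mat) \<Rightarrow> ('a \<Rightarrow> complex mat) \<Rightarrow> complex mat" where
  "clebsch_gordan G n Rs Q =
     mat (n + 1) (n + 1) (\<lambda>(i, j). rep_inner G (tensor_rep Q (Rs i)) (Rs j))"

text \<open>Here \<open>d\<close> is the dimension of \<open>R\<close>; the exterior powers of degree above \<open>d\<close> vanish.\<close>

definition clebsch_gordan_exterior ::
  "('a, 'b) monoid_scheme \<Rightarrow> nat \<Rightarrow> (nat \<Rightarrow> 'a \<Rightarrow> complex mat) \<Rightarrow> nat \<Rightarrow> ('a \<Rightarrow> complex mat)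
     \<Rightarrow> complex \<Rightarrow> complex mat" where
  "clebsch_gordan_exterior G n Rs d R q =
     mat (n + 1) (n + 1)
       (\<lambda>(i, j). \<Sum>m\<le>d. (- q) ^ m * clebsch_gordan G n Rs (exterior_power_rep m R) $$ (i, j))"

definition reduced_clebsch_gordan ::
  "('a, 'b) monoid_scheme \<Rightarrow> nat \<Rightarrow> (nat \<Rightarrow> 'a \<Rightarrow> complex mat) \<Rightarrow> nat \<Rightarrow> ('a \<Rightarrow> complex mat)
     \<Rightarrow> complex \<Rightarrow> complex mat" where
  "reduced_clebsch_gordan G n Rs d R q =
     mat_delete (clebsch_gordan_exterior G n Rs d R q) 0 0"

definition euclidean_cartan ::
  "('a, 'b) monoid_scheme \<Rightarrow> nat \<Rightarrow> (nat \<Rightarrow> 'a \<Rightarrow> complex mat) \<Rightarrow> nat \<Rightarrow> ('a \<Rightarrow> complex mat)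
     \<Rightarrow> complex mat" where
  "euclidean_cartan G n Rs d R = reduced_clebsch_gordan G n Rs d R 1"


section \<open>Eta invariants\<close>

text \<open>
  The value of the Atiyah--Patodi--Singer eta invariant of \<open>S\<^bsup>2d-1\<^esup>/G\<close> for a subgroup of
  \<open>SU(d)\<close>, taken as definition. This normalization already contains the factor \<open>1/|G|\<close>, so that
  the inverse of the Euclidean Cartan matrix is expressed through the eta invariants with
  prefactor \<open>(-1)\<^sup>d d\<^sub>i d\<^sub>j / 2\<close>, without a further division by \<open>|G|\<close>. For example, if the
  nontrivial element of the group of order 2 acts on \<open>\<complex>\<^sup>2\<close> by \<open>-1\<close>, the Euclidean Cartan matrix
  is \<open>(2)\<close> and the eta invariants are \<open>1/4\<close> and \<open>-1/4\<close>.
\<close>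

definition eta0 ::
  "('a, 'b) monoid_scheme \<Rightarrow> nat \<Rightarrow> (nat \<Rightarrow> 'a \<Rightarrow> complex mat) \<Rightarrow> (nat \<Rightarrow> 'a set) \<Rightarrow> (nat \<Rightarrow> 'a)
     \<Rightarrow> nat \<Rightarrow> ('a \<Rightarrow> complex mat) \<Rightarrow> nat \<Rightarrow> complex" where
  "eta0 G n Rs C g d R j =
     (- 1) ^ d * 2 / of_nat (Coset.order G) *
     (\<Sum>k\<in>{k. k \<le> n \<and> det (1\<^sub>m d - R (g k)) \<noteq> 0}.
        of_nat (card (C k)) * cnj (rep_char (Rs j) (g k)) / det (1\<^sub>m d - R (g k)))"

definition eta ::
  "('a, 'b) monoid_scheme \<Rightarrow> nat \<Rightarrow> (nat \<Rightarrow> 'a \<Rightarrow> complex mat) \<Rightarrow> (nat \<Rightarrow> 'a set) \<Rightarrow> (nat \<Rightarrow> 'a)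
     \<Rightarrow> nat \<Rightarrow> ('a \<Rightarrow> complex mat) \<Rightarrow> nat \<Rightarrow> nat \<Rightarrow> complex" where
  "eta G n Rs C g d R i j =
     (\<Sum>k\<le>n. rep_inner G (tensor_rep (Rs i) (Rs k)) (Rs j) * eta0 G n Rs C g d R k)"

end

theory Submission
  imports Defs "Jordan_Normal_Form.Spectral_Radius"
begin

text \<open>
  Put \<open>\<delta>(x) = det (E - R(x))\<close>. The alternating sum of the traces of the exterior powers of \<open>R(x)\<close> is
  \<open>\<delta>(x)\<close> (\<open>sum_trace_exterior_powers\<close>), so the entry of the Euclidean Cartan matrix in row \<open>i\<close> and
  column \<open>j\<close> is the inner product of \<open>\<delta> \<chi>\<^sub>i\<close> with \<open>\<chi>\<^sub>j\<close>. In the basis of characters the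
  matrix without deletion is thus multiplication by \<open>\<delta>\<close> on class functions. If \<open>G\<close> is nontrivial,
  \<open>\<delta>\<close> vanishes exactly at the identity, because the action is free, and deleting the row and the
  column of the trivial representation makes up for this zero. Accordingly the inverse is division
  by \<open>\<delta>\<close> applied to functions vanishing at the identity: with \<open>d\<^sub>j = \<chi>\<^sub>j(1)\<close>, its entries are
  \<open>1/|G|\<close> times the sum over \<open>x \<noteq> 1\<close> of \<open>(\<chi>\<^sub>i(x) - d\<^sub>i)\<close> times the conjugate of
  \<open>\<chi>\<^sub>j(x) - d\<^sub>j\<close>, divided by \<open>\<delta>(x)\<close>. That these matrices are inverse to each other is
  \<open>cartan_sum_inverse\<close>.

  Expanding the product in this sum gives four terms. Each is a multiple of an eta invariant, because
  the generalized invariant with indices \<open>i\<close> and \<open>j\<close> is, up to a constant factor, the sum over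
  \<open>x \<noteq> 1\<close> of \<open>\<chi>\<^sub>i\<close> times the conjugate of \<open>\<chi>\<^sub>j\<close>, divided by \<open>\<delta>\<close> (\<open>eta_eq_group_sum\<close>).

  Both steps rest on the fact that the irreducible characters form an orthonormal basis of the class
  functions. Orthonormality (\<open>row_orthogonality\<close>) is Schur's lemma applied to averages over the
  group; completeness (\<open>class_function_expansion\<close>) follows because the character table is square.
\<close>

section \<open>Traces of exterior powers\<close>

definition principal_minor :: "complex mat \<Rightarrow> nat set \<Rightarrow> complex" where
  "principal_minor A X = (\<Sum>p | p permutes X. of_int (sign p) * (\<Prod>i\<in>X. A $$ (i, p i)))"

text \<open>
  Expand every factor \<open>[p i = i] - A $$ (i, p i)\<close> of the Leibniz formula, letting \<open>X\<close> be the set of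
  rows from which the entry of \<open>-A\<close> is taken. Only permutations fixing the complement of \<open>X\<close>
  survive, and these are the permutations of \<open>X\<close>.
\<close>

lemma det_one_minus_eq_sum_principal_minors:
  assumes A: "A \<in> carrier_mat d d"
  shows "det (1\<^sub>m d - A) = (\<Sum>X\<in>Pow {0..<d}. (- 1) ^ card X * principal_minor A X)"
proof -
  let ?D = "{0..<d}"
  have X_term: "(\<Sum>p | p permutes ?D. of_int (sign p) *
        ((\<Prod>i\<in>X. - A $$ (i, p i)) * (\<Prod>i\<in>?D - X. if i = p i then 1 else 0)))
      = (- 1) ^ card X * principal_minor A X"
    if X: "X \<in> Pow ?D" for X
  proof -
    have fin: "finite X" using X by (auto intro: finite_subset)
    have "(\<Sum>p | p permutes ?D. of_int (sign p) *
        ((\<Prod>i\<in>X. - A $$ (i, p i)) * (\<Prod>i\<in>?D - X. if i = p i then 1 else 0)))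
      = (\<Sum>p | p permutes X. of_int (sign p) *
        ((\<Prod>i\<in>X. - A $$ (i, p i)) * (\<Prod>i\<in>?D - X. if i = p i then 1 else 0)))"
    proof (rule sum.mono_neutral_right)
      show "finite {p. p permutes ?D}" by (rule finite_permutations) simp
      show "{p. p permutes X} \<subseteq> {p. p permutes ?D}"
        using X permutes_subset by blast
      show "\<forall>p\<in>{p. p permutes ?D} - {p. p permutes X}. of_int (sign p) *
        ((\<Prod>i\<in>X. - A $$ (i, p i)) * (\<Prod>i\<in>?D - X. if i = p i then 1 else 0)) = 0"
      proof
        fix p assume p: "p \<in> {p. p permutes ?D} - {p. p permutes X}"
        then obtain i where "i \<in> ?D - X" "p i \<noteq> i"
          using permutes_superset[of p ?D X] by auto
        then have "(\<Prod>i\<in>?D - X. if i = p i then 1 else 0 :: complex) = 0"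
          by (intro prod_zero) (auto intro!: bexI[of _ i])
        then show "of_int (sign p) *
          ((\<Prod>i\<in>X. - A $$ (i, p i)) * (\<Prod>i\<in>?D - X. if i = p i then 1 else 0)) = 0"
          by simp
      qed
    qed
    also have "\<dots> = (\<Sum>p | p permutes X. of_int (sign p) * ((- 1) ^ card X * (\<Prod>i\<in>X. A $$ (i, p i))))"
    proof (rule sum.cong[OF refl])
      fix p assume p: "p \<in> {p. p permutes X}"
      have "(\<Prod>i\<in>?D - X. if i = p i then 1 else 0 :: complex) = 1"
        using p by (intro prod.neutral) (auto simp: permutes_not_in)
      moreover have "(\<Prod>i\<in>X. - A $$ (i, p i)) = (- 1) ^ card X * (\<Prod>i\<in>X. A $$ (i, p i))"
        using fin by (simp add: prod_uminus)
      ultimately show "of_int (sign p) *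
          ((\<Prod>i\<in>X. - A $$ (i, p i)) * (\<Prod>i\<in>?D - X. if i = p i then 1 else 0))
        = of_int (sign p) * ((- 1) ^ card X * (\<Prod>i\<in>X. A $$ (i, p i)))"
        by simp
    qed
    finally show ?thesis
      by (simp add: principal_minor_def sum_distrib_left mult.left_commute)
  qed
  have "det (1\<^sub>m d - A)
      = (\<Sum>p | p permutes ?D. of_int (sign p) * (\<Prod>i\<in>?D. (1\<^sub>m d - A) $$ (i, p i)))"
    by (rule det_def') (use A in auto)
  also have "\<dots> = (\<Sum>p | p permutes ?D. of_int (sign p) *
      (\<Prod>i\<in>?D. - A $$ (i, p i) + (if i = p i then 1 else 0)))"
  proof (intro sum.cong refl arg_cong2[where f = "(*)"] prod.cong)
    fix p i assume "p \<in> {p. p permutes ?D}" "i \<in> ?D"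
    then have "p i < d" "i < d"
      by (auto dest: permutes_in_image[of _ _ i])
    then show "(1\<^sub>m d - A) $$ (i, p i) = - A $$ (i, p i) + (if i = p i then 1 else 0)"
      using A by auto
  qed
  also have "\<dots> = (\<Sum>p | p permutes ?D. \<Sum>X\<in>Pow ?D. of_int (sign p) *
      ((\<Prod>i\<in>X. - A $$ (i, p i)) * (\<Prod>i\<in>?D - X. if i = p i then 1 else 0)))"
    by (simp only: prod_add finite_atLeastLessThan sum_distrib_left)
  also have "\<dots> = (\<Sum>X\<in>Pow ?D. \<Sum>p | p permutes ?D. of_int (sign p) *
      ((\<Prod>i\<in>X. - A $$ (i, p i)) * (\<Prod>i\<in>?D - X. if i = p i then 1 else 0)))"
    by (rule sum.swap)
  also have "\<dots> = (\<Sum>X\<in>Pow ?D. (- 1) ^ card X * principal_minor A X)"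
    by (rule sum.cong[OF refl X_term])
  finally show ?thesis .
qed

text \<open>
  The enumeration \<open>i \<mapsto> S ! i\<close> carries permutations of the positions to permutations of the index
  set and preserves their sign. Hence a principal minor depends on the set of indices only, not on
  the order in which they are listed.
\<close>

lemma det_submatrix_eq_principal_minor:
  assumes dist: "distinct S"
  shows "det (mat (length S) (length S) (\<lambda>(i, j). A $$ (S ! i, S ! j))) = principal_minor A (set S)"
proof -
  let ?M = "{0..<length S}"
  have bij: "bij_betw ((!) S) ?M (set S)"
    using bij_betw_nth[OF dist, of ?M "set S"] by (simp add: lessThan_atLeast0)
  have inj: "inj_on ((!) S) ?M"
    using bij by (rule bij_betw_imp_inj_on)
  have bij': "bij_betw (inv_into ?M ((!) S)) (set S) ?M"
    using bij by (rule bij_betw_inv_into)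
  have "det (mat (length S) (length S) (\<lambda>(i, j). A $$ (S ! i, S ! j)))
      = (\<Sum>p | p permutes ?M. of_int (sign p) *
          (\<Prod>i\<in>?M. mat (length S) (length S) (\<lambda>(i, j). A $$ (S ! i, S ! j)) $$ (i, p i)))"
    by (rule det_def') simp
  also have "\<dots> = (\<Sum>p | p permutes ?M. of_int (sign p) * (\<Prod>i\<in>?M. A $$ (S ! i, S ! p i)))"
  proof (intro sum.cong refl arg_cong2[where f = "(*)"] prod.cong)
    fix p i assume "p \<in> {p. p permutes ?M}" "i \<in> ?M"
    then have "p i < length S" "i < length S"
      by (auto dest: permutes_in_image[of _ _ i])
    then show "mat (length S) (length S) (\<lambda>(i, j). A $$ (S ! i, S ! j)) $$ (i, p i)
        = A $$ (S ! i, S ! p i)"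
      by simp
  qed
  also have "\<dots> = principal_minor A (set S)"
    unfolding principal_minor_def
  proof (rule sum.reindex_bij_witness[where j = "map_permutation ?M ((!) S)"
        and i = "map_permutation (set S) (inv_into ?M ((!) S))"])
    fix p assume p: "p \<in> {p. p permutes ?M}"
    show "map_permutation (set S) (inv_into ?M ((!) S)) (map_permutation ?M ((!) S) p) = p"
      using p bij inj by (intro map_permutation_compose_inv) auto
    show "map_permutation ?M ((!) S) p \<in> {p. p permutes set S}"
      using p map_permutation_permutes[OF bij] by auto
    have "(\<Prod>i\<in>set S. A $$ (i, map_permutation ?M ((!) S) p i))
        = (\<Prod>i\<in>?M. A $$ (S ! i, map_permutation ?M ((!) S) p (S ! i)))"
      by (rule prod.reindex_bij_betw[OF bij, symmetric])
    also have "\<dots> = (\<Prod>i\<in>?M. A $$ (S ! i, S ! p i))"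
      by (intro prod.cong refl) (subst map_permutation_apply[OF inj], auto)
    finally show "of_int (sign (map_permutation ?M ((!) S) p)) *
          (\<Prod>i\<in>set S. A $$ (i, map_permutation ?M ((!) S) p i))
        = of_int (sign p) * (\<Prod>i\<in>?M. A $$ (S ! i, S ! p i))"
      using p by (subst sign_map_permutation[OF inj]) auto
  next
    fix q assume q: "q \<in> {p. p permutes set S}"
    show "map_permutation ?M ((!) S) (map_permutation (set S) (inv_into ?M ((!) S)) q) = q"
      using q bij' bij by (intro map_permutation_compose_inv) (auto intro: bij_betw_inv_into_right)
    show "map_permutation (set S) (inv_into ?M ((!) S)) q \<in> {p. p permutes ?M}"
      using q map_permutation_permutes[OF bij'] by auto
  qed
  finally show ?thesis .
qed

lemma trace_exterior_power:
  assumes A: "A \<in> carrier_mat d d"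
  shows "mat_trace (exterior_power_mat m A)
    = (\<Sum>I | I \<in> set (subseqs [0..<d]) \<and> length I = m. principal_minor A (set I))"
proof -
  let ?S = "increasing_lists d m"
  have dist: "distinct (subseqs [0..<d])"
    using distinct_set_subseqs[of "[0..<d]"] by (simp add: distinct_map)
  have "mat_trace (exterior_power_mat m A)
      = (\<Sum>a<length ?S. det (mat m m (\<lambda>(i, j). A $$ (?S ! a ! i, ?S ! a ! j))))"
    using A by (auto simp: mat_trace_def exterior_power_mat_def Let_def)
  also have "\<dots> = (\<Sum>a<length ?S. principal_minor A (set (?S ! a)))"
  proof (rule sum.cong[OF refl])
    fix a assume "a \<in> {..<length ?S}"
    then have "?S ! a \<in> set ?S" by simp
    then have "?S ! a \<in> set (subseqs [0..<d])" and len: "length (?S ! a) = m"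
      unfolding increasing_lists_def by auto
    then have "distinct (?S ! a)"
      using subseqs_distinctD by fastforce
    from det_submatrix_eq_principal_minor[OF this, of A]
    show "det (mat m m (\<lambda>(i, j). A $$ (?S ! a ! i, ?S ! a ! j))) = principal_minor A (set (?S ! a))"
      by (simp add: len)
  qed
  also have "\<dots> = (\<Sum>I\<in>set ?S. principal_minor A (set I))"
    using dist by (intro sum.reindex_bij_betw bij_betw_nth) (auto simp: increasing_lists_def)
  also have "set ?S = {I. I \<in> set (subseqs [0..<d]) \<and> length I = m}"
    unfolding increasing_lists_def by auto
  finally show ?thesis .
qed

text \<open>
  The diagonal entries of the exterior powers are the principal minors, so the alternating sum of
  the traces is the expansion of \<open>det (1 - A)\<close> grouped by the size of the index set. This is
  what turns the exterior powers in the Cartan matrix into the determinants in the eta invariants.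
\<close>

lemma sum_trace_exterior_powers:
  assumes A: "A \<in> carrier_mat d d"
  shows "(\<Sum>m\<le>d. (- 1) ^ m * mat_trace (exterior_power_mat m A)) = det (1\<^sub>m d - A)"
proof -
  let ?S = "set (subseqs [0..<d])"
  have card_set: "card (set I) = length I" if "I \<in> ?S" for I
    using subseqs_distinctD[OF that] by (simp add: distinct_card)
  have len: "length I \<le> d" if "I \<in> ?S" for I
  proof -
    have "set I \<subseteq> {0..<d}" using that subseqs_powset[of "[0..<d]"] by auto
    then show ?thesis using card_mono[of "{0..<d}" "set I"] card_set[OF that] by simp
  qed
  have "(\<Sum>m\<le>d. (- 1) ^ m * mat_trace (exterior_power_mat m A))
      = (\<Sum>m\<le>d. \<Sum>I | I \<in> ?S \<and> length I = m. (- 1) ^ length I * principal_minor A (set I))"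
    by (simp add: trace_exterior_power[OF A] sum_distrib_left)
  also have "\<dots> = (\<Sum>I\<in>?S. (- 1) ^ length I * principal_minor A (set I))"
    using len by (intro sum.group) auto
  also have "\<dots> = (\<Sum>I\<in>?S. (- 1) ^ card (set I) * principal_minor A (set I))"
    by (rule sum.cong) (simp_all add: card_set)
  also have "\<dots> = (\<Sum>X\<in>set ` ?S. (- 1) ^ card X * principal_minor A X)"
    using distinct_set_subseqs[of "[0..<d]"]
    by (subst sum.reindex) (simp_all add: distinct_map o_def)
  also have "set ` ?S = Pow {0..<d}"
    by (simp add: subseqs_powset)
  finally show ?thesis
    by (simp add: det_one_minus_eq_sum_principal_minors[OF A])
qed

section \<open>Representations, traces and characters\<close>

lemma carrier_GL: "carrier (GL d) = {A \<in> carrier_mat d d. \<exists>B\<in>carrier_mat d d. B * A = 1\<^sub>m d \<and> A * B = 1\<^sub>m d}"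
  by (auto simp: GL_def units_of_def Units_def ring_mat_def)

lemma GL_simps: "A \<otimes>\<^bsub>GL d\<^esub> B = A * B" "\<one>\<^bsub>GL d\<^esub> = 1\<^sub>m d"
  by (auto simp: GL_def units_of_def ring_mat_def)

lemma group_GL: "group (GL d)"
proof -
  interpret ring "ring_mat TYPE(complex) d ()" by (rule ring_mat)
  show ?thesis unfolding GL_def by (rule units_group)
qed

lemma representation_carrier:
  assumes "representation G d \<rho>" "x \<in> carrier G"
  shows "\<rho> x \<in> carrier_mat d d"
  using assms hom_in_carrier[of \<rho> G "GL d" x] by (auto simp: representation_def carrier_GL)

lemma representation_mult:
  assumes "representation G d \<rho>" "x \<in> carrier G" "y \<in> carrier G"
  shows "\<rho> (x \<otimes>\<^bsub>G\<^esub> y) = \<rho> x * \<rho> y"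
  using assms hom_mult[of \<rho> G "GL d" x y] by (simp add: representation_def GL_simps)

lemma (in group) representation_one:
  assumes "representation G d \<rho>"
  shows "\<rho> \<one> = 1\<^sub>m d"
  using assms hom_one[of \<rho> G "GL d"] group_GL by (simp add: representation_def GL_simps is_group)

lemma (in group) representation_inv_mult:
  assumes "representation G d \<rho>" "x \<in> carrier G"
  shows "\<rho> (inv x) * \<rho> x = 1\<^sub>m d"
  using assms representation_mult[OF assms(1), of "inv x" x] representation_one[OF assms(1)] by simp

lemma representation_mult_entry:
  assumes "representation G d \<rho>" "x \<in> carrier G" "y \<in> carrier G" "i < d" "j < d"
  shows "\<rho> (x \<otimes>\<^bsub>G\<^esub> y) $$ (i, j) = (\<Sum>k<d. \<rho> x $$ (i, k) * \<rho> y $$ (k, j))"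
  using representation_carrier[OF assms(1,2)] representation_carrier[OF assms(1,3)] assms(4,5)
  by (simp add: representation_mult[OF assms(1-3)] scalar_prod_def lessThan_atLeast0)

lemma mat_trace_carrier:
  assumes "A \<in> carrier_mat d d"
  shows "mat_trace A = (\<Sum>i<d. A $$ (i, i))"
  using assms by (simp add: mat_trace_def)

lemma rep_char_eq:
  assumes "representation G d \<rho>" "x \<in> carrier G"
  shows "rep_char \<rho> x = (\<Sum>i<d. \<rho> x $$ (i, i))"
  using representation_carrier[OF assms] by (simp add: rep_char_def mat_trace_carrier)

lemma mat_trace_mult_commute:
  assumes A: "A \<in> carrier_mat m n" and B: "B \<in> carrier_mat n m"
  shows "mat_trace (A * B) = mat_trace (B * A)"
proof -
  have "mat_trace (A * B) = (\<Sum>i<m. \<Sum>j<n. A $$ (i, j) * B $$ (j, i))"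
    using A B by (simp add: mat_trace_def scalar_prod_def lessThan_atLeast0)
  also have "\<dots> = (\<Sum>j<n. \<Sum>i<m. B $$ (j, i) * A $$ (i, j))"
    by (subst sum.swap) (simp add: mult.commute)
  also have "\<dots> = mat_trace (B * A)"
    using A B by (simp add: mat_trace_def scalar_prod_def lessThan_atLeast0)
  finally show ?thesis .
qed

lemma mat_trace_one: "mat_trace (1\<^sub>m d) = of_nat d"
  by (simp add: mat_trace_def)

lemma (in group) rep_char_one:
  assumes "representation G d \<rho>"
  shows "rep_char \<rho> \<one> = of_nat d"
  using representation_one[OF assms] by (simp add: rep_char_def mat_trace_one)

lemma (in group) sum_mult_left:
  assumes "h \<in> carrier G"
  shows "(\<Sum>x\<in>carrier G. F (h \<otimes> x)) = (\<Sum>x\<in>carrier G. F x)"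
  using assms
  by (intro sum.reindex_bij_witness[where i = "\<lambda>x. inv h \<otimes> x" and j = "\<lambda>x. h \<otimes> x"])
    (simp_all add: m_assoc[symmetric])

lemma (in group) sum_mult_right:
  assumes "h \<in> carrier G"
  shows "(\<Sum>x\<in>carrier G. F (x \<otimes> h)) = (\<Sum>x\<in>carrier G. F x)"
  using assms
  by (intro sum.reindex_bij_witness[where i = "\<lambda>x. x \<otimes> inv h" and j = "\<lambda>x. x \<otimes> h"])
    (simp_all add: m_assoc)

lemma mat_trace_kronecker:
  assumes A: "A \<in> carrier_mat m m" and B: "B \<in> carrier_mat n n"
  shows "mat_trace (kronecker A B) = mat_trace A * mat_trace B"
proof -
  have "mat_trace (kronecker A B) = (\<Sum>i<m * n. A $$ (i div n, i div n) * B $$ (i mod n, i mod n))"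
    using A B by (simp add: mat_trace_def kronecker_def)
  also have "\<dots> = (\<Sum>a<m. \<Sum>i = a * n..<a * n + n. A $$ (i div n, i div n) * B $$ (i mod n, i mod n))"
    by (rule sum.nat_group[symmetric])
  also have "\<dots> = (\<Sum>a<m. \<Sum>b<n. A $$ (a, a) * B $$ (b, b))"
  proof (rule sum.cong[OF refl])
    fix a
    show "(\<Sum>i = a * n..<a * n + n. A $$ (i div n, i div n) * B $$ (i mod n, i mod n))
        = (\<Sum>b<n. A $$ (a, a) * B $$ (b, b))"
      by (rule sum.reindex_bij_witness[where i = "\<lambda>i. i - a * n" and j = "\<lambda>b. a * n + b", symmetric])
        auto
  qed
  also have "\<dots> = mat_trace A * mat_trace B"
    by (simp add: mat_trace_carrier[OF A] mat_trace_carrier[OF B] sum_product)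
  finally show ?thesis .
qed

section \<open>Schur's lemma\<close>

lemma eq_mat_if_mult_vec_eq:
  fixes A B :: "'a :: semiring_1 mat"
  assumes "A \<in> carrier_mat m n" "B \<in> carrier_mat m n"
    and "\<And>v. v \<in> carrier_vec n \<Longrightarrow> A *\<^sub>v v = B *\<^sub>v v"
  shows "A = B"
proof (rule mat_col_eqI)
  fix j assume "j < dim_col B"
  then have j: "j < n" using assms by simp
  have "col M j = M *\<^sub>v unit_vec n j" if "M \<in> carrier_mat m n" for M :: "'a mat"
    using that j by (intro eq_vecI) auto
  then show "col A j = col B j" using assms by simp
qed (use assms in auto)

lemma subspace_vecI:
  assumes "W \<subseteq> carrier_vec d" "0\<^sub>v d \<in> W"
    and "\<And>v w. v \<in> W \<Longrightarrow> w \<in> W \<Longrightarrow> v + w \<in> W" and "\<And>c v. v \<in> W \<Longrightarrow> c \<cdot>\<^sub>v v \<in> W"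
  shows "VectorSpace.subspace class_ring W (module_vec TYPE(complex) d)"
  using assms vec_vs[of d] vec_module[of d]
  by (auto simp: VectorSpace.subspace_def LinearCombinations.submodule_def module_vec_simps)

lemma irreducible_repD:
  assumes "irreducible_rep G d \<rho>"
  shows "representation G d \<rho>" "d > 0"
  using assms by (auto simp: irreducible_rep_def)

lemma irreducible_rep_subspace:
  assumes "irreducible_rep G d \<rho>" "W \<subseteq> carrier_vec d" "0\<^sub>v d \<in> W"
    and "\<And>v w. v \<in> W \<Longrightarrow> w \<in> W \<Longrightarrow> v + w \<in> W" and "\<And>c v. v \<in> W \<Longrightarrow> c \<cdot>\<^sub>v v \<in> W"
    and "\<And>x v. x \<in> carrier G \<Longrightarrow> v \<in> W \<Longrightarrow> \<rho> x *\<^sub>v v \<in> W"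
  shows "W = {0\<^sub>v d} \<or> W = carrier_vec d"
  using assms(1,6) subspace_vecI[OF assms(2-5)] by (auto simp: irreducible_rep_def)

text \<open>
  Schur's lemma. The kernel and the image of an intertwiner are invariant, so a nonzero intertwiner
  is bijective. Its inverse \<open>S\<close> is assembled column by column from preimages of the unit vectors;
  the equality of the dimensions then comes from \<open>tr (T S) = tr (S T)\<close>.
\<close>

lemma schur_zero_or_equivalent:
  assumes \<rho>: "irreducible_rep G m \<rho>" and \<sigma>: "irreducible_rep G n \<sigma>"
    and T: "T \<in> carrier_mat m n"
    and comm: "\<And>x. x \<in> carrier G \<Longrightarrow> \<rho> x * T = T * \<sigma> x"
  shows "T = 0\<^sub>m m n \<or> equivalent_reps G m \<rho> n \<sigma>"
proof (cases "T = 0\<^sub>m m n")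
  case False
  note \<rho>c = representation_carrier[OF irreducible_repD(1)[OF \<rho>]]
  note \<sigma>c = representation_carrier[OF irreducible_repD(1)[OF \<sigma>]]
  have move: "\<rho> x *\<^sub>v (T *\<^sub>v v) = T *\<^sub>v (\<sigma> x *\<^sub>v v)" if "x \<in> carrier G" "v \<in> carrier_vec n" for x v
    using assoc_mult_mat_vec[OF \<rho>c T, of x v] assoc_mult_mat_vec[OF T \<sigma>c, of x v] that comm by simp
  let ?K = "{v \<in> carrier_vec n. T *\<^sub>v v = 0\<^sub>v m}"
  let ?I = "(\<lambda>v. T *\<^sub>v v) ` carrier_vec n"
  have nz: "\<exists>v\<in>carrier_vec n. T *\<^sub>v v \<noteq> 0\<^sub>v m"
  proof (rule ccontr)
    assume "\<not> ?thesis"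
    then have "T = 0\<^sub>m m n" using T by (intro eq_mat_if_mult_vec_eq[where m = m and n = n]) auto
    with False show False by simp
  qed
  have "?K = {0\<^sub>v n} \<or> ?K = carrier_vec n"
  proof (rule irreducible_rep_subspace[OF \<sigma>])
    fix x v assume x: "x \<in> carrier G" and v: "v \<in> ?K"
    then have "T *\<^sub>v (\<sigma> x *\<^sub>v v) = \<rho> x *\<^sub>v 0\<^sub>v m" using move[of x v] by simp
    also have "\<dots> = 0\<^sub>v m" using \<rho>c[OF x] by auto
    finally show "\<sigma> x *\<^sub>v v \<in> ?K" using \<sigma>c[OF x] v by auto
  next
    fix v w assume "v \<in> ?K" "w \<in> ?K"
    then show "v + w \<in> ?K" using T by (auto simp: mult_add_distrib_mat_vec[OF T])
  next
    fix c v assume "v \<in> ?K"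
    then show "c \<cdot>\<^sub>v v \<in> ?K" using T by (auto simp: mult_mat_vec[OF T])
  qed (use T in auto)
  then have K: "?K = {0\<^sub>v n}" using nz by blast
  have "?I = {0\<^sub>v m} \<or> ?I = carrier_vec m"
  proof (rule irreducible_rep_subspace[OF \<rho>])
    fix x v assume x: "x \<in> carrier G" and "v \<in> ?I"
    then obtain w where w: "w \<in> carrier_vec n" "v = T *\<^sub>v w" by auto
    then show "\<rho> x *\<^sub>v v \<in> ?I" using move[OF x w(1)] \<sigma>c[OF x] by auto
  next
    fix v w assume "v \<in> ?I" "w \<in> ?I"
    then obtain v' w' where "v' \<in> carrier_vec n" "v = T *\<^sub>v v'" "w' \<in> carrier_vec n" "w = T *\<^sub>v w'"
      by auto
    then show "v + w \<in> ?I"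
      by (intro image_eqI[of _ _ "v' + w'"]) (auto simp: mult_add_distrib_mat_vec[OF T])
  next
    fix c v assume "v \<in> ?I"
    then obtain v' where "v' \<in> carrier_vec n" "v = T *\<^sub>v v'" by auto
    then show "c \<cdot>\<^sub>v v \<in> ?I"
      by (intro image_eqI[of _ _ "c \<cdot>\<^sub>v v'"]) (auto simp: mult_mat_vec[OF T])
  next
    show "0\<^sub>v m \<in> ?I" using T by (intro image_eqI[of _ _ "0\<^sub>v n"]) auto
  qed (use T in auto)
  then have I: "?I = carrier_vec m" using nz by blast
  have "\<exists>v. v \<in> carrier_vec n \<and> T *\<^sub>v v = unit_vec m j" for j
  proof -
    have "unit_vec m j \<in> ?I" using I by simp
    then show ?thesis by auto
  qed
  then obtain s where s: "\<And>j. s j \<in> carrier_vec n" "\<And>j. T *\<^sub>v s j = unit_vec m j" by metis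
  define S where "S = mat_of_cols n (map s [0..<m])"
  have S: "S \<in> carrier_mat n m"
    using mat_of_cols_carrier(1)[of n "map s [0..<m]"] by (simp add: S_def)
  have TS: "T * S = 1\<^sub>m m"
  proof (rule mat_col_eqI)
    fix j assume "j < dim_col (1\<^sub>m m :: complex mat)"
    then have j: "j < m" by simp
    then have "col (T * S) j = T *\<^sub>v col S j" using T S by (auto simp: col_mult2)
    also have "col S j = s j" using j s(1) by (simp add: S_def)
    finally show "col (T * S) j = col (1\<^sub>m m) j" using j s(2) by simp
  qed (use T S in auto)
  have ST: "S * T = 1\<^sub>m n"
  proof (rule eq_mat_if_mult_vec_eq)
    fix v :: "complex vec" assume v: "v \<in> carrier_vec n"
    let ?w = "S *\<^sub>v (T *\<^sub>v v)"
    have w: "?w \<in> carrier_vec n" using S T v by auto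
    have "T *\<^sub>v ?w = (T * S) *\<^sub>v (T *\<^sub>v v)"
      using T S v by (intro assoc_mult_mat_vec[symmetric]) auto
    then have "T *\<^sub>v (?w - v) = 0\<^sub>v m"
      using T v w by (simp add: mult_minus_distrib_mat_vec[OF T] TS)
    then have "?w - v \<in> ?K" using v w by auto
    then have "?w - v = 0\<^sub>v n" using K by auto
    then have "?w = v" using v w S by (auto simp: vec_eq_iff)
    then show "S * T *\<^sub>v v = 1\<^sub>m n *\<^sub>v v" using S T v by (simp add: assoc_mult_mat_vec)
  qed (use S T in auto)
  have "of_nat m = (of_nat n :: complex)"
    using mat_trace_mult_commute[OF T S] by (simp add: TS ST mat_trace_one)
  then have mn: "m = n" by simp
  have "S * \<rho> x = \<sigma> x * S" if x: "x \<in> carrier G" for x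
  proof -
    have "S * \<rho> x = S * (\<rho> x * (T * S))" using \<rho>c[OF x] TS by simp
    also have "\<dots> = S * ((\<rho> x * T) * S)" using assoc_mult_mat[OF \<rho>c[OF x] T S] by simp
    also have "\<dots> = S * (T * \<sigma> x * S)" using comm[OF x] by simp
    also have "\<dots> = (S * T) * (\<sigma> x * S)"
      using assoc_mult_mat[OF T \<sigma>c[OF x] S] assoc_mult_mat[OF S T mult_carrier_mat[OF \<sigma>c[OF x] S]]
      by simp
    finally show ?thesis using \<sigma>c[OF x] S by (simp add: ST)
  qed
  moreover have "S \<in> carrier (GL m)"
    using S T TS ST mn by (auto simp: carrier_GL)
  ultimately show ?thesis using mn by (auto simp: equivalent_reps_def)
qed simp

text \<open>
  Over the complex numbers an endomorphism has an eigenvalue, and its eigenspace is invariant.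
\<close>

lemma schur_scalar:
  assumes \<rho>: "irreducible_rep G d \<rho>" and T: "T \<in> carrier_mat d d"
    and comm: "\<And>x. x \<in> carrier G \<Longrightarrow> \<rho> x * T = T * \<rho> x"
  obtains c where "T = c \<cdot>\<^sub>m 1\<^sub>m d"
proof -
  note \<rho>c = representation_carrier[OF irreducible_repD(1)[OF \<rho>]]
  from spectrum_non_empty[OF T irreducible_repD(2)[OF \<rho>]]
  obtain c v where v: "v \<in> carrier_vec d" "v \<noteq> 0\<^sub>v d" "T *\<^sub>v v = c \<cdot>\<^sub>v v"
    using T by (auto simp: spectrum_def eigenvalue_def eigenvector_def)
  let ?W = "{v \<in> carrier_vec d. T *\<^sub>v v = c \<cdot>\<^sub>v v}"
  have "?W = {0\<^sub>v d} \<or> ?W = carrier_vec d"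
  proof (rule irreducible_rep_subspace[OF \<rho>])
    fix x v assume x: "x \<in> carrier G" and v: "v \<in> ?W"
    then have "T *\<^sub>v (\<rho> x *\<^sub>v v) = \<rho> x *\<^sub>v (T *\<^sub>v v)"
      using assoc_mult_mat_vec[OF \<rho>c[OF x] T, of v] assoc_mult_mat_vec[OF T \<rho>c[OF x], of v] comm
      by simp
    also have "\<dots> = c \<cdot>\<^sub>v (\<rho> x *\<^sub>v v)" using v \<rho>c[OF x] by (simp add: mult_mat_vec)
    finally show "\<rho> x *\<^sub>v v \<in> ?W" using \<rho>c[OF x] v by auto
  next
    fix v w assume "v \<in> ?W" "w \<in> ?W"
    then show "v + w \<in> ?W"
      by (auto simp: mult_add_distrib_mat_vec[OF T] smult_add_distrib_vec)
  next
    fix a v assume "v \<in> ?W"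
    then show "a \<cdot>\<^sub>v v \<in> ?W"
      by (auto simp: mult_mat_vec[OF T] smult_smult_assoc mult.commute)
  qed (use T in auto)
  then have W: "?W = carrier_vec d" using v by blast
  have "T = c \<cdot>\<^sub>m 1\<^sub>m d"
  proof (rule eq_mat_if_mult_vec_eq[OF T])
    fix v :: "complex vec" assume v: "v \<in> carrier_vec d"
    have "(c \<cdot>\<^sub>m 1\<^sub>m d) *\<^sub>v v = c \<cdot>\<^sub>v v"
    proof (rule eq_vecI)
      fix i assume "i < dim_vec (c \<cdot>\<^sub>v v)"
      then have i: "i < d" using v by simp
      then have "((c \<cdot>\<^sub>m 1\<^sub>m d) *\<^sub>v v) $ i = (c \<cdot>\<^sub>v unit_vec d i) \<bullet> v" by simp
      also have "\<dots> = c * v $ i" using v i by (simp add: scalar_prod_left_unit)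
      finally show "((c \<cdot>\<^sub>m 1\<^sub>m d) *\<^sub>v v) $ i = (c \<cdot>\<^sub>v v) $ i" using v i by simp
    qed (use v in simp)
    then show "T *\<^sub>v v = (c \<cdot>\<^sub>m 1\<^sub>m d) *\<^sub>v v"
      using W v by auto
  qed simp
  then show thesis by (rule that)
qed

section \<open>Orthogonality of irreducible characters\<close>

text \<open>
  The average \<open>\<Sum>\<^sub>x \<rho>(x) E\<^sub>a\<^sub>b \<sigma>(inv x)\<close> of a matrix unit \<open>E\<^sub>a\<^sub>b\<close>, written out entrywise. Such averages
  are intertwiners, to which Schur's lemma applies, and their entries are the sums of products of
  matrix coefficients that make up the inner products of characters.
\<close>

definition average_mat ::
  "('a, 'b) monoid_scheme \<Rightarrow> nat \<Rightarrow> ('a \<Rightarrow> complex mat) \<Rightarrow> nat \<Rightarrow> ('a \<Rightarrow> complex mat)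
    \<Rightarrow> nat \<Rightarrow> nat \<Rightarrow> complex mat" where
  "average_mat G m \<rho> n \<sigma> a b =
    mat m n (\<lambda>(p, q). \<Sum>x\<in>carrier G. \<rho> x $$ (p, a) * \<sigma> (inv\<^bsub>G\<^esub> x) $$ (b, q))"

lemma (in group) average_mat_commutes:
  assumes \<rho>: "representation G m \<rho>" and \<sigma>: "representation G n \<sigma>"
    and a: "a < m" and b: "b < n" and h: "h \<in> carrier G"
  shows "\<rho> h * average_mat G m \<rho> n \<sigma> a b = average_mat G m \<rho> n \<sigma> a b * \<sigma> h"
proof (rule eq_matI)
  note \<rho>h = representation_carrier[OF \<rho> h] and \<sigma>h = representation_carrier[OF \<sigma> h]
  let ?T = "average_mat G m \<rho> n \<sigma> a b"
  fix p q assume "p < dim_row (?T * \<sigma> h)" "q < dim_col (?T * \<sigma> h)"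
  then have p: "p < m" and q: "q < n" using \<sigma>h by (auto simp: average_mat_def)
  have "(\<rho> h * ?T) $$ (p, q) = (\<Sum>r<m. \<Sum>x\<in>carrier G. \<rho> h $$ (p, r) * (\<rho> x $$ (r, a) * \<sigma> (inv x) $$ (b, q)))"
    using p q \<rho>h by (simp add: average_mat_def scalar_prod_def lessThan_atLeast0 sum_distrib_left)
  also have "\<dots> = (\<Sum>x\<in>carrier G. \<rho> (h \<otimes> x) $$ (p, a) * \<sigma> (inv x) $$ (b, q))"
    using p q a h by (subst sum.swap)
      (simp add: representation_mult_entry[OF \<rho>] sum_distrib_right mult.assoc)
  also have "\<dots> = (\<Sum>x\<in>carrier G. \<rho> (h \<otimes> x) $$ (p, a) * \<sigma> (inv (h \<otimes> x) \<otimes> h) $$ (b, q))"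
    using h by (intro sum.cong refl) (simp add: inv_mult_group m_assoc)
  also have "\<dots> = (\<Sum>x\<in>carrier G. \<rho> x $$ (p, a) * \<sigma> (inv x \<otimes> h) $$ (b, q))"
    by (rule sum_mult_left[OF h])
  also have "\<dots> = (\<Sum>x\<in>carrier G. \<Sum>r<n. \<rho> x $$ (p, a) * \<sigma> (inv x) $$ (b, r) * \<sigma> h $$ (r, q))"
    using p q b h
    by (simp add: representation_mult_entry[OF \<sigma>] sum_distrib_left mult.assoc)
  also have "\<dots> = (\<Sum>r<n. \<Sum>x\<in>carrier G. \<rho> x $$ (p, a) * \<sigma> (inv x) $$ (b, r) * \<sigma> h $$ (r, q))"
    by (rule sum.swap)
  also have "\<dots> = (?T * \<sigma> h) $$ (p, q)"
    using p q \<sigma>h by (simp add: average_mat_def scalar_prod_def lessThan_atLeast0 sum_distrib_right)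
  finally show "(\<rho> h * ?T) $$ (p, q) = (?T * \<sigma> h) $$ (p, q)" .
qed (use representation_carrier[OF \<rho> h] representation_carrier[OF \<sigma> h] in \<open>auto simp: average_mat_def\<close>)

lemma (in group) sum_char_mult_char_inv:
  assumes \<rho>: "representation G m \<rho>" and \<sigma>: "representation G n \<sigma>"
  shows "(\<Sum>x\<in>carrier G. rep_char \<rho> x * rep_char \<sigma> (inv x))
    = (\<Sum>p<m. \<Sum>q<n. average_mat G m \<rho> n \<sigma> p q $$ (p, q))"
proof -
  have "(\<Sum>x\<in>carrier G. rep_char \<rho> x * rep_char \<sigma> (inv x))
      = (\<Sum>x\<in>carrier G. \<Sum>p<m. \<Sum>q<n. \<rho> x $$ (p, p) * \<sigma> (inv x) $$ (q, q))"
    by (simp add: rep_char_eq[OF \<rho>] rep_char_eq[OF \<sigma>] sum_product)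
  also have "\<dots> = (\<Sum>p<m. \<Sum>x\<in>carrier G. \<Sum>q<n. \<rho> x $$ (p, p) * \<sigma> (inv x) $$ (q, q))"
    by (rule sum.swap)
  also have "\<dots> = (\<Sum>p<m. \<Sum>q<n. \<Sum>x\<in>carrier G. \<rho> x $$ (p, p) * \<sigma> (inv x) $$ (q, q))"
    by (rule sum.cong[OF refl sum.swap])
  finally show ?thesis by (simp add: average_mat_def)
qed

lemma (in group) sum_char_inequivalent:
  assumes \<rho>: "irreducible_rep G m \<rho>" and \<sigma>: "irreducible_rep G n \<sigma>"
    and ne: "\<not> equivalent_reps G m \<rho> n \<sigma>"
  shows "(\<Sum>x\<in>carrier G. rep_char \<rho> x * rep_char \<sigma> (inv x)) = 0"
proof -
  note r = irreducible_repD(1)[OF \<rho>] and s = irreducible_repD(1)[OF \<sigma>]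
  have "average_mat G m \<rho> n \<sigma> p q = 0\<^sub>m m n" if "p < m" "q < n" for p q
    using schur_zero_or_equivalent[OF \<rho> \<sigma> _ average_mat_commutes[OF r s that]] ne
    by (auto simp: average_mat_def)
  then show ?thesis
    by (simp add: sum_char_mult_char_inv[OF r s])
qed

text \<open>
  Each average of a matrix unit is a scalar matrix, and its trace determines the scalar: it is
  \<open>|G| / d\<close> for the diagonal matrix units and 0 for the others.
\<close>

lemma (in group) sum_char_irreducible:
  assumes \<rho>: "irreducible_rep G d \<rho>"
  shows "(\<Sum>x\<in>carrier G. rep_char \<rho> x * rep_char \<rho> (inv x)) = of_nat (Coset.order G)"
proof -
  note r = irreducible_repD(1)[OF \<rho>]
  have entry: "average_mat G d \<rho> d \<rho> p q $$ (p, q) = (if p = q then of_nat (Coset.order G) / of_nat d else 0)"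
    if p: "p < d" and q: "q < d" for p q
  proof -
    let ?T = "average_mat G d \<rho> d \<rho> p q"
    have "?T \<in> carrier_mat d d" by (simp add: average_mat_def)
    then obtain c where c: "?T = c \<cdot>\<^sub>m 1\<^sub>m d"
      using schur_scalar[OF \<rho> _ average_mat_commutes[OF r r p q]] by blast
    have "of_nat d * c = (\<Sum>k<d. ?T $$ (k, k))"
      by (simp add: c)
    also have "\<dots> = (\<Sum>x\<in>carrier G. \<Sum>k<d. \<rho> (inv x) $$ (q, k) * \<rho> x $$ (k, p))"
      by (subst sum.swap) (simp add: average_mat_def mult.commute)
    also have "\<dots> = (\<Sum>x\<in>carrier G. (1\<^sub>m d) $$ (q, p))"
    proof (rule sum.cong[OF refl])
      fix x assume x: "x \<in> carrier G"
      have "(\<Sum>k<d. \<rho> (inv x) $$ (q, k) * \<rho> x $$ (k, p)) = \<rho> (inv x \<otimes> x) $$ (q, p)"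
        using x p q by (simp only: representation_mult_entry[OF r] inv_closed)
      then show "(\<Sum>k<d. \<rho> (inv x) $$ (q, k) * \<rho> x $$ (k, p)) = (1\<^sub>m d) $$ (q, p)"
        using x representation_one[OF r] by simp
    qed
    also have "\<dots> = (if p = q then of_nat (Coset.order G) else 0)"
      using p q by (simp add: Coset.order_def)
    finally have "c = (if p = q then of_nat (Coset.order G) / of_nat d else 0)"
      using p by (auto simp: field_simps)
    then show ?thesis using p q by (simp add: c)
  qed
  have "(\<Sum>x\<in>carrier G. rep_char \<rho> x * rep_char \<rho> (inv x))
      = (\<Sum>p<d. \<Sum>q<d. if p = q then of_nat (Coset.order G) / of_nat d else 0)"
    by (simp add: sum_char_mult_char_inv[OF r r] entry)
  also have "\<dots> = of_nat (Coset.order G)"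
    using irreducible_repD(2)[OF \<rho>] by simp
  finally show ?thesis .
qed

text \<open>
  Averaging the standard Hermitian form over \<open>G\<close> yields an invariant form with Gram matrix \<open>H\<close>,
  that is \<open>H \<rho>(inv h) = A H\<close> for the adjoint \<open>A\<close> of \<open>\<rho>(h)\<close>. It is positive definite, so \<open>H\<close> is
  invertible and \<open>\<rho>(inv h)\<close> is similar to \<open>A\<close>.
\<close>

lemma (in group) rep_char_inv:
  assumes fin: "finite (carrier G)" and \<rho>: "representation G d \<rho>" and h: "h \<in> carrier G"
  shows "rep_char \<rho> (inv h) = cnj (rep_char \<rho> h)"
proof -
  note c = representation_carrier[OF \<rho>]
  define H where "H = mat d d (\<lambda>(p, q). \<Sum>x\<in>carrier G. \<Sum>r<d. cnj (\<rho> x $$ (r, p)) * \<rho> x $$ (r, q))"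
  define A where "A = mat d d (\<lambda>(p, q). cnj (\<rho> h $$ (q, p)))"
  have H: "H \<in> carrier_mat d d" and A: "A \<in> carrier_mat d d" by (simp_all add: H_def A_def)
  have hi: "inv h \<in> carrier G" using h by simp
  have HA: "H * \<rho> (inv h) = A * H"
  proof (rule eq_matI)
    fix p q assume "p < dim_row (A * H)" "q < dim_col (A * H)"
    then have p: "p < d" and q: "q < d" using A H by auto
    have "(H * \<rho> (inv h)) $$ (p, q)
        = (\<Sum>s<d. \<Sum>x\<in>carrier G. \<Sum>r<d. cnj (\<rho> x $$ (r, p)) * \<rho> x $$ (r, s) * \<rho> (inv h) $$ (s, q))"
      using p q c[OF hi] by (simp add: H_def scalar_prod_def lessThan_atLeast0 sum_distrib_right)
    also have "\<dots> = (\<Sum>x\<in>carrier G. \<Sum>s<d. \<Sum>r<d. cnj (\<rho> x $$ (r, p)) * \<rho> x $$ (r, s) * \<rho> (inv h) $$ (s, q))"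
      by (rule sum.swap)
    also have "\<dots> = (\<Sum>x\<in>carrier G. \<Sum>r<d. \<Sum>s<d. cnj (\<rho> x $$ (r, p)) * \<rho> x $$ (r, s) * \<rho> (inv h) $$ (s, q))"
      by (rule sum.cong[OF refl sum.swap])
    also have "\<dots> = (\<Sum>x\<in>carrier G. \<Sum>r<d. cnj (\<rho> x $$ (r, p)) * \<rho> (x \<otimes> inv h) $$ (r, q))"
      using q hi by (simp add: representation_mult_entry[OF \<rho>] sum_distrib_left mult.assoc)
    also have "\<dots> = (\<Sum>x\<in>carrier G. \<Sum>r<d. cnj (\<rho> ((x \<otimes> inv h) \<otimes> h) $$ (r, p)) * \<rho> (x \<otimes> inv h) $$ (r, q))"
      using h by (intro sum.cong refl) (simp add: m_assoc)
    also have "\<dots> = (\<Sum>x\<in>carrier G. \<Sum>r<d. cnj (\<rho> (x \<otimes> h) $$ (r, p)) * \<rho> x $$ (r, q))"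
      by (rule sum_mult_right[OF hi])
    also have "\<dots> = (\<Sum>x\<in>carrier G. \<Sum>r<d. \<Sum>s<d. cnj (\<rho> h $$ (s, p)) * (cnj (\<rho> x $$ (r, s)) * \<rho> x $$ (r, q)))"
      using p h by (simp add: representation_mult_entry[OF \<rho>] sum_distrib_right sum_distrib_left mult_ac)
    also have "\<dots> = (\<Sum>x\<in>carrier G. \<Sum>s<d. \<Sum>r<d. cnj (\<rho> h $$ (s, p)) * (cnj (\<rho> x $$ (r, s)) * \<rho> x $$ (r, q)))"
      by (rule sum.cong[OF refl sum.swap])
    also have "\<dots> = (\<Sum>s<d. \<Sum>x\<in>carrier G. \<Sum>r<d. cnj (\<rho> h $$ (s, p)) * (cnj (\<rho> x $$ (r, s)) * \<rho> x $$ (r, q)))"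
      by (rule sum.swap)
    also have "\<dots> = (A * H) $$ (p, q)"
      using p q by (simp add: A_def H_def scalar_prod_def lessThan_atLeast0 sum_distrib_left)
    finally show "(H * \<rho> (inv h)) $$ (p, q) = (A * H) $$ (p, q)" .
  qed (use A H c[OF hi] in auto)
  have "det H \<noteq> 0"
  proof
    assume "det H = 0"
    then obtain v where v: "v \<in> carrier_vec d" "v \<noteq> 0\<^sub>v d" "H *\<^sub>v v = 0\<^sub>v d"
      using det_0_iff_vec_prod_zero_field[OF H] by auto
    \<comment> \<open>\<open>N x\<close> is the squared length of \<open>\<rho> x v\<close>; these add up to the value of the invariant form at \<open>v\<close>.\<close>
    define N where "N x = (\<Sum>r<d. (cmod (\<Sum>q<d. \<rho> x $$ (r, q) * v $ q))\<^sup>2)" for x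
    have N: "complex_of_real (N x)
        = (\<Sum>r<d. \<Sum>p<d. \<Sum>q<d. cnj (v $ p) * (cnj (\<rho> x $$ (r, p)) * \<rho> x $$ (r, q)) * v $ q)" for x
    proof -
      have "complex_of_real (N x)
          = (\<Sum>r<d. cnj (\<Sum>p<d. \<rho> x $$ (r, p) * v $ p) * (\<Sum>q<d. \<rho> x $$ (r, q) * v $ q))"
        unfolding N_def by (simp only: of_real_sum complex_norm_square mult.commute)
      also have "\<dots> = (\<Sum>r<d. \<Sum>p<d. \<Sum>q<d. cnj (v $ p) * (cnj (\<rho> x $$ (r, p)) * \<rho> x $$ (r, q)) * v $ q)"
        unfolding cnj_sum sum_product by (simp add: mult_ac)
      finally show ?thesis .
    qed
    have "complex_of_real (\<Sum>x\<in>carrier G. N x)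
        = (\<Sum>x\<in>carrier G. \<Sum>p<d. \<Sum>r<d. \<Sum>q<d. cnj (v $ p) * (cnj (\<rho> x $$ (r, p)) * \<rho> x $$ (r, q)) * v $ q)"
      unfolding of_real_sum N by (rule sum.cong[OF refl sum.swap])
    also have "\<dots> = (\<Sum>p<d. \<Sum>x\<in>carrier G. \<Sum>r<d. \<Sum>q<d. cnj (v $ p) * (cnj (\<rho> x $$ (r, p)) * \<rho> x $$ (r, q)) * v $ q)"
      by (rule sum.swap)
    also have "\<dots> = (\<Sum>p<d. \<Sum>x\<in>carrier G. \<Sum>q<d. \<Sum>r<d. cnj (v $ p) * (cnj (\<rho> x $$ (r, p)) * \<rho> x $$ (r, q)) * v $ q)"
      by (rule sum.cong[OF refl], rule sum.cong[OF refl sum.swap])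
    also have "\<dots> = (\<Sum>p<d. \<Sum>q<d. \<Sum>x\<in>carrier G. \<Sum>r<d. cnj (v $ p) * (cnj (\<rho> x $$ (r, p)) * \<rho> x $$ (r, q)) * v $ q)"
      by (rule sum.cong[OF refl sum.swap])
    also have "\<dots> = (\<Sum>p<d. cnj (v $ p) * (H *\<^sub>v v) $ p)"
      using v(1) by (simp add: H_def scalar_prod_def lessThan_atLeast0 sum_distrib_left sum_distrib_right mult.assoc)
    also have "\<dots> = 0" by (simp add: v(3))
    finally have "(\<Sum>x\<in>carrier G. N x) = 0" by (simp only: of_real_eq_0_iff)
    then have "N \<one> = 0"
      using fin by (subst (asm) sum_nonneg_eq_0_iff) (auto simp: N_def intro: sum_nonneg)
    moreover have "N \<one> = (\<Sum>r<d. (cmod (v $ r))\<^sup>2)"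
      unfolding N_def representation_one[OF \<rho>]
    proof (intro sum.cong refl)
      fix r assume "r \<in> {..<d}"
      then have "(\<Sum>q<d. 1\<^sub>m d $$ (r, q) * v $ q) = (\<Sum>q<d. if q = r then v $ q else 0)"
        by (intro sum.cong) auto
      also have "\<dots> = v $ r" using \<open>r \<in> {..<d}\<close> by simp
      finally show "(cmod (\<Sum>q<d. 1\<^sub>m d $$ (r, q) * v $ q))\<^sup>2 = (cmod (v $ r))\<^sup>2" by simp
    qed
    ultimately have "\<forall>r<d. v $ r = 0"
      by (simp add: sum_nonneg_eq_0_iff)
    then have "v = 0\<^sub>v d" using v(1) by auto
    with v(2) show False by simp
  qed
  then obtain K where K: "K \<in> carrier_mat d d" "H * K = 1\<^sub>m d" "K * H = 1\<^sub>m d"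
    using det_non_zero_imp_unit[OF H, of "()"] by (auto simp: Units_def ring_mat_def)
  have "\<rho> (inv h) = K * (A * H)"
    using K H c[OF hi] by (simp add: HA[symmetric] assoc_mult_mat[symmetric])
  then have "rep_char \<rho> (inv h) = mat_trace (A * H * K)"
    using mat_trace_mult_commute[of K d d "A * H"] K A H by (simp add: rep_char_def)
  also have "A * H * K = A" using A H K by (simp add: assoc_mult_mat)
  finally show ?thesis
    by (simp add: mat_trace_def A_def rep_char_eq[OF \<rho> h])
qed

lemma irreps_up_to_isoD:
  assumes "irreps_up_to_iso G n dm Rs"
  shows "i \<le> n \<Longrightarrow> irreducible_rep G (dm i) (Rs i)"
    and "i \<le> n \<Longrightarrow> representation G (dm i) (Rs i)"
    and "i \<le> n \<Longrightarrow> dm i > 0"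
    and "i \<le> n \<Longrightarrow> j \<le> n \<Longrightarrow> equivalent_reps G (dm i) (Rs i) (dm j) (Rs j) \<Longrightarrow> i = j"
    and "dm 0 = 1"
    and "x \<in> carrier G \<Longrightarrow> rep_char (Rs 0) x = 1"
proof -
  show irr: "irreducible_rep G (dm i) (Rs i)" if "i \<le> n"
    using assms that unfolding irreps_up_to_iso_def by blast
  show "representation G (dm i) (Rs i)" "dm i > 0" if "i \<le> n"
    using irreducible_repD[OF irr[OF that]] by blast+
  show "i = j" if "i \<le> n" "j \<le> n" "equivalent_reps G (dm i) (Rs i) (dm j) (Rs j)"
    using assms that unfolding irreps_up_to_iso_def by blast
  show "dm 0 = 1"
    using assms unfolding irreps_up_to_iso_def by blast
  show "rep_char (Rs 0) x = 1" if "x \<in> carrier G"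
  proof -
    have "Rs 0 x = 1\<^sub>m 1" using assms that unfolding irreps_up_to_iso_def by blast
    then show ?thesis by (simp add: rep_char_def mat_trace_one)
  qed
qed

lemma (in group) row_orthogonality:
  assumes fin: "finite (carrier G)" and irr: "irreps_up_to_iso G n dm Rs"
    and i: "i \<le> n" and j: "j \<le> n"
  shows "(\<Sum>x\<in>carrier G. rep_char (Rs i) x * cnj (rep_char (Rs j) x))
    = (if i = j then of_nat (Coset.order G) else 0)"
proof -
  note D = irreps_up_to_isoD[OF irr]
  have "(\<Sum>x\<in>carrier G. rep_char (Rs i) x * cnj (rep_char (Rs j) x))
      = (\<Sum>x\<in>carrier G. rep_char (Rs i) x * rep_char (Rs j) (inv x))"
    by (simp add: rep_char_inv[OF fin D(2)[OF j]])
  then show ?thesis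
    using sum_char_irreducible[OF D(1)[OF i]] sum_char_inequivalent[OF D(1)[OF i] D(1)[OF j]] D(4)[OF i j]
    by auto
qed

section \<open>Class functions and completeness of the characters\<close>

definition class_function :: "('a, 'b) monoid_scheme \<Rightarrow> ('a \<Rightarrow> complex) \<Rightarrow> bool" where
  "class_function G f \<longleftrightarrow>
    (\<forall>x\<in>carrier G. \<forall>h\<in>carrier G. f (h \<otimes>\<^bsub>G\<^esub> x \<otimes>\<^bsub>G\<^esub> inv\<^bsub>G\<^esub> h) = f x)"

lemma class_function_mult:
  "class_function G f \<Longrightarrow> class_function G f' \<Longrightarrow> class_function G (\<lambda>x. f x * f' x)"
  by (simp add: class_function_def)

lemma class_function_divide:
  "class_function G f \<Longrightarrow> class_function G f' \<Longrightarrow> class_function G (\<lambda>x. f x / f' x)"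
  by (simp add: class_function_def)

lemma class_function_cnj:
  "class_function G f \<Longrightarrow> class_function G (\<lambda>x. cnj (f x))"
  by (simp add: class_function_def)

lemma (in group) representation_conj:
  assumes \<rho>: "representation G d \<rho>" and "x \<in> carrier G" "h \<in> carrier G"
  shows "\<rho> (h \<otimes> x \<otimes> inv h) = \<rho> h * \<rho> x * \<rho> (inv h)"
  using assms by (simp add: representation_mult[OF \<rho>])

lemma (in group) class_function_rep_char:
  assumes \<rho>: "representation G d \<rho>"
  shows "class_function G (rep_char \<rho>)"
  unfolding class_function_def
proof (intro ballI)
  fix x h assume x: "x \<in> carrier G" and h: "h \<in> carrier G"
  note c = representation_carrier[OF \<rho>]
  have hi: "inv h \<in> carrier G" using h by simp
  have "mat_trace (\<rho> h * \<rho> x * \<rho> (inv h)) = mat_trace (\<rho> (inv h) * (\<rho> h * \<rho> x))"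
    using c[OF h] c[OF x] c[OF hi] by (intro mat_trace_mult_commute[of _ d d]) auto
  also have "\<rho> (inv h) * (\<rho> h * \<rho> x) = \<rho> (inv h) * \<rho> h * \<rho> x"
    using c[OF h] c[OF x] c[OF hi] by (simp add: assoc_mult_mat)
  also have "\<dots> = \<rho> x"
    using c[OF x] representation_inv_mult[OF \<rho> h] by simp
  finally show "rep_char \<rho> (h \<otimes> x \<otimes> inv h) = rep_char \<rho> x"
    by (simp add: rep_char_def representation_conj[OF \<rho> x h])
qed

lemma (in group) class_function_det_one_minus:
  assumes \<rho>: "representation G d \<rho>"
  shows "class_function G (\<lambda>x. det (1\<^sub>m d - \<rho> x))"
  unfolding class_function_def
proof (intro ballI)
  fix x h assume x: "x \<in> carrier G" and h: "h \<in> carrier G"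
  note c = representation_carrier[OF \<rho>]
  have hi: "inv h \<in> carrier G" using h by simp
  have inverse: "\<rho> h * \<rho> (inv h) = 1\<^sub>m d"
    using representation_inv_mult[OF \<rho> hi] h by simp
  have "\<rho> h * (1\<^sub>m d - \<rho> x) = \<rho> h - \<rho> h * \<rho> x"
    using mult_minus_distrib_mat[OF c[OF h] one_carrier_mat c[OF x]] c[OF h] by simp
  moreover have "(\<rho> h - \<rho> h * \<rho> x) * \<rho> (inv h) = 1\<^sub>m d - \<rho> h * \<rho> x * \<rho> (inv h)"
    using minus_mult_distrib_mat[OF c[OF h] mult_carrier_mat[OF c[OF h] c[OF x]] c[OF hi]]
    by (simp add: inverse)
  ultimately have "1\<^sub>m d - \<rho> h * \<rho> x * \<rho> (inv h) = \<rho> h * (1\<^sub>m d - \<rho> x) * \<rho> (inv h)"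
    by simp
  moreover have diff: "1\<^sub>m d - \<rho> x \<in> carrier_mat d d"
    using c[OF x] by auto
  ultimately have "det (1\<^sub>m d - \<rho> h * \<rho> x * \<rho> (inv h)) = det (\<rho> h) * det (1\<^sub>m d - \<rho> x) * det (\<rho> (inv h))"
    using det_mult[OF mult_carrier_mat[OF c[OF h] diff] c[OF hi]] det_mult[OF c[OF h] diff] by simp
  moreover have "det (\<rho> h) * det (\<rho> (inv h)) = 1"
    using det_mult[OF c[OF h] c[OF hi]] by (simp add: inverse)
  ultimately show "det (1\<^sub>m d - \<rho> (h \<otimes> x \<otimes> inv h)) = det (1\<^sub>m d - \<rho> x)"
    by (simp add: representation_conj[OF \<rho> x h] mult_ac)
qed

lemma (in group) conj_classes_partition: "partition (carrier G) (conj_classes G)"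
  unfolding conj_classes_def by (rule group_action.orbit_partition[OF action_by_conjugation])

lemma (in group) sum_class_function:
  fixes n :: nat
  assumes fin: "finite (carrier G)" and C: "bij_betw C {0..n} (conj_classes G)"
    and g: "\<And>k. k \<le> n \<Longrightarrow> g k \<in> C k" and f: "class_function G f"
  shows "(\<Sum>x\<in>carrier G. f x) = (\<Sum>k\<le>n. of_nat (card (C k)) * f (g k))"
proof -
  interpret partition "carrier G" "conj_classes G" by (rule conj_classes_partition)
  have Ck: "C k \<in> conj_classes G" if "k \<le> n" for k
    using bij_betwE[OF C] that by (simp add: Ball_def)
  have const: "f x = f (g k)" if k: "k \<le> n" and x: "x \<in> C k" for k x
  proof -
    obtain y where y: "y \<in> carrier G" "C k = {h \<otimes> y \<otimes> inv h | h. h \<in> carrier G}"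
      using Ck[OF k] by (auto simp: conj_classes_def orbits_def orbit_def)
    have "f z = f y" if "z \<in> C k" for z
      using that y f by (auto simp: class_function_def)
    from this[OF x] this[OF g[OF k]] show ?thesis by simp
  qed
  have "(\<Sum>x\<in>carrier G. f x) = (\<Sum>x\<in>\<Union>(conj_classes G). f x)"
    by (simp add: partition_coverture)
  also have "\<dots> = (\<Sum>c\<in>conj_classes G. \<Sum>x\<in>c. f x)"
  proof (subst sum.Union_disjoint)
    show "\<forall>A\<in>conj_classes G. finite A" using incl fin finite_subset by blast
    show "\<forall>A\<in>conj_classes G. \<forall>B\<in>conj_classes G. A \<noteq> B \<longrightarrow> A \<inter> B = {}"
      using disjoint_union by blast
  qed simp
  also have "\<dots> = (\<Sum>k\<in>{0..n}. \<Sum>x\<in>C k. f x)"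
    by (rule sum.reindex_bij_betw[OF C, symmetric])
  also have "\<dots> = (\<Sum>k\<in>{0..n}. \<Sum>x\<in>C k. f (g k))"
    by (intro sum.cong refl const) simp_all
  also have "\<dots> = (\<Sum>k\<le>n. of_nat (card (C k)) * f (g k))"
    by (simp add: atLeast0AtMost)
  finally show ?thesis .
qed

text \<open>
  The irreducible characters are a basis of the class functions. By the orthogonality relations the
  character table \<open>X\<close> has the right inverse \<open>Y\<close>. As there are as many conjugacy classes as
  irreducible representations, \<open>X\<close> is square and \<open>Y\<close> is also a left inverse; the entries of
  \<open>Y * X\<close> are the orthogonality relations of the columns, which say that the expansion is correct
  for the indicator functions of the classes.
\<close>

lemma (in group) class_function_expansion:
  assumes fin: "finite (carrier G)" and irr: "irreps_up_to_iso G n dm Rs"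
    and C: "bij_betw C {0..n} (conj_classes G)"
    and f: "class_function G f" and h: "h \<in> carrier G"
  shows "(\<Sum>j\<le>n. (1 / of_nat (Coset.order G) * (\<Sum>x\<in>carrier G. f x * cnj (rep_char (Rs j) x)))
    * rep_char (Rs j) h) = f h"
proof -
  note D = irreps_up_to_isoD[OF irr]
  interpret partition "carrier G" "conj_classes G" by (rule conj_classes_partition)
  let ?N = "of_nat (Coset.order G) :: complex"
  have N: "?N \<noteq> 0" using fin order_gt_0_iff_finite by auto
  obtain l where l: "l \<le> n" "h \<in> C l"
  proof -
    obtain c where "c \<in> conj_classes G" "h \<in> c" using unique_class[OF h] by blast
    moreover from this(1) obtain l where "l \<in> {0..n}" "c = C l"
      using bij_betw_imp_surj_on[OF C] by blast
    ultimately show thesis using that[of l] by simp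
  qed
  have ne: "\<exists>x. x \<in> C k" if "k \<le> n" for k
  proof -
    have "C k \<in> conj_classes G" using bij_betwE[OF C] that by (simp add: Ball_def)
    then show ?thesis by (auto simp: conj_classes_def orbits_def orbit_def)
  qed
  \<comment> \<open>Representatives of the classes, chosen so that \<open>h\<close> represents its own class.\<close>
  define g where "g k = (if k = l then h else SOME x. x \<in> C k)" for k
  have g: "g k \<in> C k" if "k \<le> n" for k
    using l ne[OF that] by (auto simp: g_def intro: someI_ex)
  have gl: "g l = h" by (simp add: g_def)
  have class_sum: "(\<Sum>x\<in>carrier G. f1 x * cnj (rep_char (Rs j) x))
      = (\<Sum>k\<le>n. of_nat (card (C k)) * (f1 (g k) * cnj (rep_char (Rs j) (g k))))"
    if "class_function G f1" "j \<le> n" for f1 j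
    by (rule sum_class_function[OF fin C g])
      (auto intro!: class_function_mult that class_function_cnj class_function_rep_char[OF D(2)])
  define X where "X = mat (n + 1) (n + 1) (\<lambda>(j, k). rep_char (Rs j) (g k))"
  define Y where "Y = mat (n + 1) (n + 1)
    (\<lambda>(k, j). of_nat (card (C k)) * cnj (rep_char (Rs j) (g k)) / ?N)"
  have X: "X \<in> carrier_mat (n + 1) (n + 1)" and Y: "Y \<in> carrier_mat (n + 1) (n + 1)"
    by (simp_all add: X_def Y_def)
  have "X * Y = 1\<^sub>m (n + 1)"
  proof (rule eq_matI)
    fix i j assume "i < dim_row (1\<^sub>m (n + 1))" "j < dim_col (1\<^sub>m (n + 1))"
    then have i: "i \<le> n" and j: "j \<le> n" by auto
    have "(X * Y) $$ (i, j)
        = (\<Sum>k\<le>n. of_nat (card (C k)) * (rep_char (Rs i) (g k) * cnj (rep_char (Rs j) (g k)))) / ?N"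
      using i j by (simp add: X_def Y_def scalar_prod_def sum_divide_distrib atLeast0AtMost
          atLeastLessThanSuc_atLeastAtMost mult_ac del: sum.op_ivl_Suc)
    also have "\<dots> = (if i = j then 1 else 0)"
      using N by (simp add: class_sum[OF class_function_rep_char[OF D(2)[OF i]] j, symmetric]
          row_orthogonality[OF fin irr i j])
    finally show "(X * Y) $$ (i, j) = 1\<^sub>m (n + 1) $$ (i, j)" using i j by simp
  qed (auto simp: X_def Y_def)
  then have YX: "Y * X = 1\<^sub>m (n + 1)"
    by (rule mat_mult_left_right_inverse[OF X Y])
  have column: "(\<Sum>j\<le>n. of_nat (card (C k)) * cnj (rep_char (Rs j) (g k)) / ?N * rep_char (Rs j) h)
      = (if k = l then 1 else 0)" if k: "k \<le> n" for k
  proof -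
    have "(Y * X) $$ (k, l)
        = (\<Sum>j\<le>n. of_nat (card (C k)) * cnj (rep_char (Rs j) (g k)) / ?N * rep_char (Rs j) h)"
      using k l by (simp add: X_def Y_def scalar_prod_def gl atLeast0AtMost
          atLeastLessThanSuc_atLeastAtMost del: sum.op_ivl_Suc)
    then show ?thesis using k l by (simp add: YX)
  qed
  have "(\<Sum>j\<le>n. (1 / ?N * (\<Sum>x\<in>carrier G. f x * cnj (rep_char (Rs j) x))) * rep_char (Rs j) h)
      = (\<Sum>j\<le>n. \<Sum>k\<le>n. f (g k) * (of_nat (card (C k)) * cnj (rep_char (Rs j) (g k)) / ?N * rep_char (Rs j) h))"
    by (simp add: class_sum[OF f] sum_distrib_left sum_distrib_right mult_ac)
  also have "\<dots> = (\<Sum>k\<le>n. f (g k) *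
      (\<Sum>j\<le>n. of_nat (card (C k)) * cnj (rep_char (Rs j) (g k)) / ?N * rep_char (Rs j) h))"
    by (subst sum.swap) (simp only: sum_distrib_left)
  also have "\<dots> = (\<Sum>k\<le>n. if k = l then f h else 0)"
  proof (rule sum.cong[OF refl])
    fix k assume "k \<in> {..n}"
    then have k: "k \<le> n" by simp
    show "f (g k) * (\<Sum>j\<le>n. of_nat (card (C k)) * cnj (rep_char (Rs j) (g k)) / ?N * rep_char (Rs j) h)
        = (if k = l then f h else 0)"
      unfolding column[OF k] by (simp add: gl)
  qed
  also have "\<dots> = f h" using l by simp
  finally show ?thesis .
qed

section \<open>Clebsch--Gordan matrices and eta invariants as sums over the group\<close>

lemma rep_char_tensor:
  assumes "\<rho> x \<in> carrier_mat m m" "\<sigma> x \<in> carrier_mat n n"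
  shows "rep_char (tensor_rep \<rho> \<sigma>) x = rep_char \<rho> x * rep_char \<sigma> x"
  using mat_trace_kronecker[OF assms] by (simp add: rep_char_def tensor_rep_def)

lemma clebsch_gordan_exterior_entry:
  assumes irr: "irreps_up_to_iso G n dm Rs" and R: "representation G d R"
    and i: "i \<le> n" and j: "j \<le> n"
  shows "clebsch_gordan_exterior G n Rs d R 1 $$ (i, j) = 1 / of_nat (Coset.order G) *
    (\<Sum>x\<in>carrier G. det (1\<^sub>m d - R x) * rep_char (Rs i) x * cnj (rep_char (Rs j) x))"
proof -
  let ?N = "of_nat (Coset.order G) :: complex"
  note c = representation_carrier[OF R] and ci = representation_carrier[OF irreps_up_to_isoD(2)[OF irr i]]
  have tensor: "rep_char (tensor_rep (exterior_power_rep m R) (Rs i)) x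
      = mat_trace (exterior_power_mat m (R x)) * rep_char (Rs i) x" if x: "x \<in> carrier G" for m x
  proof -
    let ?l = "length (increasing_lists (dim_row (R x)) m)"
    have "exterior_power_rep m R x \<in> carrier_mat ?l ?l"
      by (simp add: exterior_power_rep_def exterior_power_mat_def Let_def)
    from rep_char_tensor[where \<rho> = "exterior_power_rep m R" and \<sigma> = "Rs i" and x = x, OF this ci[OF x]]
    show ?thesis
      by (simp add: rep_char_def exterior_power_rep_def)
  qed
  have "clebsch_gordan_exterior G n Rs d R 1 $$ (i, j)
      = (\<Sum>m\<le>d. (- 1) ^ m * (1 / ?N * (\<Sum>x\<in>carrier G.
          mat_trace (exterior_power_mat m (R x)) * rep_char (Rs i) x * cnj (rep_char (Rs j) x))))"
    using i j by (simp add: clebsch_gordan_exterior_def clebsch_gordan_def rep_inner_def tensor)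
  also have "\<dots> = (\<Sum>m\<le>d. \<Sum>x\<in>carrier G. 1 / ?N * ((- 1) ^ m *
          mat_trace (exterior_power_mat m (R x)) * rep_char (Rs i) x * cnj (rep_char (Rs j) x)))"
    by (simp add: sum_distrib_left sum_divide_distrib mult.assoc)
  also have "\<dots> = (\<Sum>x\<in>carrier G. 1 / ?N * ((\<Sum>m\<le>d. (- 1) ^ m *
          mat_trace (exterior_power_mat m (R x))) * rep_char (Rs i) x * cnj (rep_char (Rs j) x)))"
    by (subst sum.swap) (simp add: sum_distrib_right sum_divide_distrib)
  also have "\<dots> = (\<Sum>x\<in>carrier G. 1 / ?N *
      (det (1\<^sub>m d - R x) * rep_char (Rs i) x * cnj (rep_char (Rs j) x)))"
    by (simp add: sum_trace_exterior_powers[OF c])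
  finally show ?thesis by (simp only: sum_distrib_left)
qed

text \<open>
  Twisting by the coefficients \<open>(R\<^sub>i \<otimes> R\<^sub>k, R\<^sub>j)\<close> replaces the conjugate of \<open>\<chi>\<^sub>j\<close> in the formula
  for the eta invariant by its product with \<open>\<chi>\<^sub>i\<close>: these coefficients are the coordinates of this
  product with respect to the conjugates of the irreducible characters. Since division by 0
  yields 0, the sum may range over the whole group: the elements with vanishing determinant
  contribute nothing.
\<close>

lemma (in group) eta_eq_group_sum:
  assumes fin: "finite (carrier G)" and irr: "irreps_up_to_iso G n dm Rs"
    and C: "bij_betw C {0..n} (conj_classes G)"
    and g: "\<And>k. k \<le> n \<Longrightarrow> g k \<in> C k"
    and R: "representation G d R"
    and i: "i \<le> n" and j: "j \<le> n"
  shows "eta G n Rs C g d R i j = (- 1) ^ d * 2 / of_nat (Coset.order G) *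
    (\<Sum>x\<in>carrier G. rep_char (Rs i) x * cnj (rep_char (Rs j) x) / det (1\<^sub>m d - R x))"
proof -
  note D = irreps_up_to_isoD[OF irr]
  let ?N = "of_nat (Coset.order G) :: complex"
  let ?c = "(- 1) ^ d * 2 / ?N"
  let ?\<delta> = "\<lambda>x. det (1\<^sub>m d - R x)"
  let ?\<chi> = "\<lambda>k. rep_char (Rs k)"
  have eta0: "eta0 G n Rs C g d R k = ?c * (\<Sum>x\<in>carrier G. cnj (?\<chi> k x) / ?\<delta> x)"
    if k: "k \<le> n" for k
  proof -
    have cf: "class_function G (\<lambda>x. cnj (?\<chi> k x) / ?\<delta> x)"
      by (intro class_function_divide class_function_cnj class_function_rep_char[OF D(2)[OF k]]
          class_function_det_one_minus[OF R])
    have "(\<Sum>l\<in>{l. l \<le> n \<and> ?\<delta> (g l) \<noteq> 0}. of_nat (card (C l)) * cnj (?\<chi> k (g l)) / ?\<delta> (g l))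
        = (\<Sum>l\<le>n. of_nat (card (C l)) * cnj (?\<chi> k (g l)) / ?\<delta> (g l))"
      by (rule sum.mono_neutral_left) auto
    also have "\<dots> = (\<Sum>x\<in>carrier G. cnj (?\<chi> k x) / ?\<delta> x)"
      by (simp add: sum_class_function[OF fin C g cf])
    finally show ?thesis by (simp add: eta0_def)
  qed
  have inner: "rep_inner G (tensor_rep (Rs i) (Rs k)) (Rs j)
      = 1 / ?N * (\<Sum>y\<in>carrier G. ?\<chi> i y * cnj (?\<chi> j y) * ?\<chi> k y)" if k: "k \<le> n" for k
  proof -
    have "rep_char (tensor_rep (Rs i) (Rs k)) x = ?\<chi> i x * ?\<chi> k x" if x: "x \<in> carrier G" for x
      by (rule rep_char_tensor)
        (rule representation_carrier[OF D(2)[OF i] x] representation_carrier[OF D(2)[OF k] x])+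
    then show ?thesis by (simp add: rep_inner_def mult_ac)
  qed
  have expand: "(\<Sum>k\<le>n. 1 / ?N * (\<Sum>y\<in>carrier G. ?\<chi> i y * cnj (?\<chi> j y) * ?\<chi> k y) * cnj (?\<chi> k x))
      = ?\<chi> i x * cnj (?\<chi> j x)" if x: "x \<in> carrier G" for x
  proof -
    have "class_function G (\<lambda>y. cnj (?\<chi> i y) * ?\<chi> j y)"
      by (intro class_function_mult class_function_cnj class_function_rep_char[OF D(2)] i j)
    from arg_cong[OF class_function_expansion[OF fin irr C this x], of cnj]
    show ?thesis by simp
  qed
  have "eta G n Rs C g d R i j = (\<Sum>k\<le>n. (1 / ?N * (\<Sum>y\<in>carrier G. ?\<chi> i y * cnj (?\<chi> j y) * ?\<chi> k y)) *
      (?c * (\<Sum>x\<in>carrier G. cnj (?\<chi> k x) / ?\<delta> x)))"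
    unfolding eta_def by (rule sum.cong[OF refl]) (simp only: atMost_iff eta0 inner)
  also have "\<dots> = (\<Sum>k\<le>n. \<Sum>x\<in>carrier G. ?c * ((1 / ?N * (\<Sum>y\<in>carrier G. ?\<chi> i y * cnj (?\<chi> j y) * ?\<chi> k y)) *
      cnj (?\<chi> k x)) / ?\<delta> x)"
    by (intro sum.cong refl) (simp add: sum_distrib_left mult.left_commute)
  also have "\<dots> = (\<Sum>x\<in>carrier G. ?c * (\<Sum>k\<le>n. (1 / ?N * (\<Sum>y\<in>carrier G. ?\<chi> i y * cnj (?\<chi> j y) * ?\<chi> k y)) *
      cnj (?\<chi> k x)) / ?\<delta> x)"
    by (subst sum.swap) (simp only: sum_distrib_left sum_divide_distrib)
  also have "\<dots> = (\<Sum>x\<in>carrier G. ?c * (?\<chi> i x * cnj (?\<chi> j x)) / ?\<delta> x)"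
    by (rule sum.cong[OF refl]) (simp only: expand)
  also have "\<dots> = ?c * (\<Sum>x\<in>carrier G. ?\<chi> i x * cnj (?\<chi> j x) / ?\<delta> x)"
    by (simp only: sum_distrib_left times_divide_eq_right)
  finally show ?thesis .
qed

section \<open>Free actions and the inverse of the Cartan matrix\<close>

lemma (in group) det_one_minus_eq_0_imp_one:
  assumes R: "representation G d R" and faithful: "faithful G R" and free: "acts_freely G d R"
    and x: "x \<in> carrier G" and det: "det (1\<^sub>m d - R x) = 0"
  shows "x = \<one>"
proof -
  note c = representation_carrier[OF R x]
  have "1\<^sub>m d - R x \<in> carrier_mat d d" using c by auto
  then obtain v where v: "v \<in> carrier_vec d" "v \<noteq> 0\<^sub>v d" "(1\<^sub>m d - R x) *\<^sub>v v = 0\<^sub>v d"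
    using det det_0_iff_vec_prod_zero_field by blast
  have "v - R x *\<^sub>v v = 0\<^sub>v d"
    using v(3) minus_mult_distrib_mat_vec[OF one_carrier_mat c v(1)] v(1) by simp
  then have "R x *\<^sub>v v = v"
    using v(1) c by (auto simp: vec_eq_iff)
  then have "R x = R \<one>"
    using free v(1,2) x representation_one[OF R] by (auto simp: acts_freely_def)
  then show ?thesis
    using faithful x by (auto simp: faithful_def inj_on_def)
qed

text \<open>
  A determinant of size 0 equals 1, so only for \<open>d > 0\<close> does \<open>det (1 - R x)\<close> vanish at the
  identity. A faithful representation of dimension 0 exists for the trivial group only, which has
  no nontrivial irreducible representation.
\<close>

lemma (in group) dimension_pos_if_faithful:
  assumes fin: "finite (carrier G)" and irr: "irreps_up_to_iso G n dm Rs" and n: "0 < n"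
    and R: "representation G d R" and faithful: "faithful G R"
  shows "0 < d"
proof (rule ccontr)
  assume "\<not> 0 < d"
  then have d: "d = 0" by simp
  have "x = \<one>" if x: "x \<in> carrier G" for x
  proof -
    have "R x = R \<one>"
      using representation_carrier[OF R x] representation_carrier[OF R one_closed] d
      by (intro eq_matI) auto
    then show ?thesis using faithful x by (auto simp: faithful_def inj_on_def)
  qed
  then have "carrier G = {\<one>}" by auto
  moreover have "(1::nat) \<le> n" using n by simp
  ultimately have "of_nat (dm 1) = (0 :: complex)"
    using row_orthogonality[OF fin irr, of 1 0] irreps_up_to_isoD(6)[OF irr one_closed]
      rep_char_one[OF irreps_up_to_isoD(2)[OF irr, of 1]] by simp
  then show False using irreps_up_to_isoD(3)[OF irr, of 1] \<open>1 \<le> n\<close> by simp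
qed

text \<open>
  Let \<open>a\<^sub>j\<close> be the coordinates of the class function \<open>\<delta> \<chi>\<^sub>i\<close>. The difference \<open>\<chi>\<^sub>j - d\<^sub>j\<close> vanishes
  identically for \<open>j = 0\<close>, so the sum over \<open>j \<ge> 1\<close> is one over all \<open>j\<close>, and
  \<open>\<Sum>\<^sub>j a\<^sub>j (\<chi>\<^sub>j - d\<^sub>j)\<close> is \<open>\<delta> \<chi>\<^sub>i\<close> minus its value at the identity, which is 0. The division by
  \<open>\<delta>\<close> cancels the factor \<open>\<delta>\<close>, also at the identity, since \<open>\<chi>\<^sub>k - d\<^sub>k\<close> vanishes there. What
  remains is the inner product of \<open>\<chi>\<^sub>i\<close> with \<open>\<chi>\<^sub>k - d\<^sub>k \<chi>\<^sub>0\<close>.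
\<close>

lemma (in group) cartan_sum_inverse:
  fixes n :: nat
  assumes fin: "finite (carrier G)" and irr: "irreps_up_to_iso G n dm Rs"
    and C: "bij_betw C {0..n} (conj_classes G)"
    and \<delta>: "class_function G \<delta>" and \<delta>1: "\<delta> \<one> = 0"
    and \<delta>0: "\<And>x. x \<in> carrier G \<Longrightarrow> \<delta> x = 0 \<Longrightarrow> x = \<one>"
    and i: "i \<in> {1..n}" and k: "k \<in> {1..n}"
  shows "(\<Sum>j\<in>{1..n}.
      (1 / of_nat (Coset.order G) * (\<Sum>x\<in>carrier G. \<delta> x * rep_char (Rs i) x * cnj (rep_char (Rs j) x))) *
      (1 / of_nat (Coset.order G) * (\<Sum>x\<in>carrier G. (rep_char (Rs j) x - of_nat (dm j)) *
        cnj (rep_char (Rs k) x - of_nat (dm k)) / \<delta> x)))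
    = (if i = k then 1 else 0)"
proof -
  note D = irreps_up_to_isoD[OF irr]
  let ?N = "of_nat (Coset.order G) :: complex"
  let ?\<chi> = "\<lambda>k. rep_char (Rs k)"
  let ?w = "\<lambda>x. cnj (?\<chi> k x - of_nat (dm k))"
  have N: "?N \<noteq> 0" using fin order_gt_0_iff_finite by auto
  have i': "i \<le> n" "i \<noteq> 0" and k': "k \<le> n" using i k by auto
  define a where "a j = 1 / ?N * (\<Sum>x\<in>carrier G. \<delta> x * ?\<chi> i x * cnj (?\<chi> j x))" for j
  have cf: "class_function G (\<lambda>x. \<delta> x * ?\<chi> i x)"
    by (intro class_function_mult \<delta> class_function_rep_char[OF D(2)] i')
  have expand: "(\<Sum>j\<le>n. a j * ?\<chi> j x) = \<delta> x * ?\<chi> i x" if "x \<in> carrier G" for x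
    unfolding a_def by (rule class_function_expansion[OF fin irr C cf that])
  have "(\<Sum>j\<le>n. a j * of_nat (dm j)) = (\<Sum>j\<le>n. a j * ?\<chi> j \<one>)"
    by (rule sum.cong) (simp_all add: rep_char_one[OF D(2)])
  then have expand_one: "(\<Sum>j\<le>n. a j * of_nat (dm j)) = 0"
    by (simp add: expand \<delta>1)
  have cancel: "\<delta> x * ?\<chi> i x * (?w x / \<delta> x) = ?\<chi> i x * ?w x" if x: "x \<in> carrier G" for x
  proof (cases "\<delta> x = 0")
    case True
    then show ?thesis using \<delta>0[OF x] rep_char_one[OF D(2)[OF k']] by simp
  qed simp
  have "(\<Sum>j\<in>{1..n}. a j * (1 / ?N * (\<Sum>x\<in>carrier G. (?\<chi> j x - of_nat (dm j)) * ?w x / \<delta> x)))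
      = (\<Sum>j\<le>n. a j * (1 / ?N * (\<Sum>x\<in>carrier G. (?\<chi> j x - of_nat (dm j)) * ?w x / \<delta> x)))"
  proof (rule sum.mono_neutral_left)
    show "\<forall>j\<in>{..n} - {1..n}.
        a j * (1 / ?N * (\<Sum>x\<in>carrier G. (?\<chi> j x - of_nat (dm j)) * ?w x / \<delta> x)) = 0"
    proof
      fix j assume "j \<in> {..n} - {1..n}"
      then have "j = 0" by auto
      then show "a j * (1 / ?N * (\<Sum>x\<in>carrier G. (?\<chi> j x - of_nat (dm j)) * ?w x / \<delta> x)) = 0"
        by (simp add: D(5,6))
    qed
  qed auto
  also have "\<dots> = (\<Sum>j\<le>n. \<Sum>x\<in>carrier G. 1 / ?N * ((a j * ?\<chi> j x - a j * of_nat (dm j)) * (?w x / \<delta> x)))"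
    unfolding sum_distrib_left by (intro sum.cong refl, unfold right_diff_distrib[symmetric]) simp
  also have "\<dots> = (\<Sum>x\<in>carrier G. 1 / ?N * (((\<Sum>j\<le>n. a j * ?\<chi> j x) - (\<Sum>j\<le>n. a j * of_nat (dm j))) * (?w x / \<delta> x)))"
    by (subst sum.swap) (simp only: sum_distrib_left[symmetric] sum_distrib_right[symmetric] sum_subtractf)
  also have "\<dots> = (\<Sum>x\<in>carrier G. 1 / ?N * (?\<chi> i x * ?w x))"
    by (rule sum.cong[OF refl]) (simp only: expand expand_one diff_zero cancel)
  also have "\<dots> = 1 / ?N * ((\<Sum>x\<in>carrier G. ?\<chi> i x * cnj (?\<chi> k x))
      - of_nat (dm k) * (\<Sum>x\<in>carrier G. ?\<chi> i x * cnj (?\<chi> 0 x)))"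
    by (simp add: D(6) sum_distrib_left sum_subtractf[symmetric] algebra_simps)
  also have "\<dots> = (if i = k then 1 else 0)"
    using N i' by (simp add: row_orthogonality[OF fin irr i'(1) k'] row_orthogonality[OF fin irr i'(1), of 0])
  finally show ?thesis by (simp only: a_def)
qed

theorem mainTheorem10:
  fixes G :: "('a, 'b) monoid_scheme"
    and R :: "'a \<Rightarrow> complex mat" and d :: nat
    and n :: nat and dm :: "nat \<Rightarrow> nat" and Rs :: "nat \<Rightarrow> 'a \<Rightarrow> complex mat"
    and C :: "nat \<Rightarrow> 'a set" and g :: "nat \<Rightarrow> 'a"
  assumes "group G" and "finite (carrier G)"
    and "irreps_up_to_iso G n dm Rs"
    and "bij_betw C {0..n} (conj_classes G)"
    and "\<And>k. k \<le> n \<Longrightarrow> g k \<in> C k" and "g 0 = \<one>\<^bsub>G\<^esub>"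
    and "representation G d R" and "faithful G R"
    and "acts_freely G d R" and "R ` carrier G \<subseteq> SU d"
  shows "\<exists>B\<in>carrier_mat n n.
    inverts_mat (euclidean_cartan G n Rs d R) B \<and>
    inverts_mat B (euclidean_cartan G n Rs d R) \<and>
    (\<forall>i\<in>{1..n}. \<forall>j\<in>{1..n}.
      B $$ (i - 1, j - 1) =
        (- 1) ^ d * of_nat (dm i) * of_nat (dm j) / 2 *
        (eta G n Rs C g d R 0 0
          - eta G n Rs C g d R i 0 / of_nat (dm i)
          - eta G n Rs C g d R 0 j / of_nat (dm j)
          + eta G n Rs C g d R i j / (of_nat (dm i) * of_nat (dm j))))"
proof -
  interpret group G by fact
  note fin = assms(2) and irr = assms(3) and C = assms(4) and g = assms(5) and R = assms(7)
  note D = irreps_up_to_isoD[OF irr]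
  let ?N = "of_nat (Coset.order G) :: complex"
  let ?\<delta> = "\<lambda>x. det (1\<^sub>m d - R x)"
  let ?\<chi> = "\<lambda>k. rep_char (Rs k)"
  let ?\<eta> = "eta G n Rs C g d R"
  \<comment> \<open>The term of the identity is \<open>0 / 0 = 0\<close> when \<open>d > 0\<close>, so this is the sum over \<open>x \<noteq> 1\<close>.\<close>
  define b where "b i j = 1 / ?N * (\<Sum>x\<in>carrier G.
    (?\<chi> i x - of_nat (dm i)) * cnj (?\<chi> j x - of_nat (dm j)) / ?\<delta> x)" for i j
  define B where "B = mat n n (\<lambda>(i, j). b (i + 1) (j + 1))"
  let ?E = "euclidean_cartan G n Rs d R"
  have B: "B \<in> carrier_mat n n" by (simp add: B_def)
  have E: "?E \<in> carrier_mat n n"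
    by (simp add: euclidean_cartan_def reduced_clebsch_gordan_def mat_delete_def clebsch_gordan_exterior_def)
  have E_entry: "?E $$ (i, j) = 1 / ?N *
      (\<Sum>x\<in>carrier G. ?\<delta> x * ?\<chi> (i + 1) x * cnj (?\<chi> (j + 1) x))" if "i < n" "j < n" for i j
  proof -
    have "?E $$ (i, j) = clebsch_gordan_exterior G n Rs d R 1 $$ (i + 1, j + 1)"
      using that by (simp add: euclidean_cartan_def reduced_clebsch_gordan_def mat_delete_def
          clebsch_gordan_exterior_def)
    then show ?thesis
      using that by (simp add: clebsch_gordan_exterior_entry[OF irr R])
  qed
  have EB: "?E * B = 1\<^sub>m n"
  proof (rule eq_matI)
    fix i k assume "i < dim_row (1\<^sub>m n :: complex mat)" "k < dim_col (1\<^sub>m n :: complex mat)"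
    then have i: "i < n" and k: "k < n" by auto
    then have "0 < d" using dimension_pos_if_faithful[OF fin irr _ R assms(8)] by simp
    have "det (1\<^sub>m d - 1\<^sub>m d :: complex mat) = det (0 \<cdot>\<^sub>m 1\<^sub>m d)"
      by (rule arg_cong[where f = det], rule eq_matI) auto
    also have "\<dots> = 0"
      using \<open>0 < d\<close> by (simp only: det_smult) simp
    finally have \<delta>1: "?\<delta> \<one>\<^bsub>G\<^esub> = 0"
      by (simp only: representation_one[OF R])
    have "(?E * B) $$ (i, k) = (\<Sum>j = 0..<n. ?E $$ (i, j) * b (j + 1) (k + 1))"
      using i k E by (simp add: scalar_prod_def B_def)
    also have "\<dots> = (\<Sum>j\<in>{1..n}. (1 / ?N *
        (\<Sum>x\<in>carrier G. ?\<delta> x * ?\<chi> (i + 1) x * cnj (?\<chi> j x))) * b j (k + 1))"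
      by (rule sum.reindex_bij_witness[where i = "\<lambda>j. j - 1" and j = "\<lambda>j. j + 1"])
        (use i in \<open>auto simp: E_entry\<close>)
    also have "\<dots> = (if i + 1 = k + 1 then 1 else 0)"
      unfolding b_def using i k
      by (intro cartan_sum_inverse[OF fin irr C class_function_det_one_minus[OF R] \<delta>1
            det_one_minus_eq_0_imp_one[OF R assms(8,9)]]) auto
    finally show "(?E * B) $$ (i, k) = 1\<^sub>m n $$ (i, k)" using i k by simp
  qed (use E B in auto)
  have BE: "B * ?E = 1\<^sub>m n" by (rule mat_mult_left_right_inverse[OF E B EB])
  have entry: "b i j = (- 1) ^ d * of_nat (dm i) * of_nat (dm j) / 2 *
      (?\<eta> 0 0 - ?\<eta> i 0 / of_nat (dm i) - ?\<eta> 0 j / of_nat (dm j)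
        + ?\<eta> i j / (of_nat (dm i) * of_nat (dm j)))" if i: "i \<le> n" and j: "j \<le> n" for i j
  proof -
    note \<eta> = eta_eq_group_sum[OF fin irr C g R]
    define S where "S i j = (\<Sum>x\<in>carrier G. ?\<chi> i x * cnj (?\<chi> j x) / ?\<delta> x)" for i j
    have di: "of_nat (dm i) \<noteq> (0 :: complex)" and dj: "of_nat (dm j) \<noteq> (0 :: complex)"
      using D(3) i j by auto
    have sign: "(- 1) ^ d * (- 1) ^ d = (1 :: complex)"
      by (simp add: power_mult_distrib[symmetric])
    have "(\<Sum>x\<in>carrier G. (?\<chi> i x - of_nat (dm i)) * cnj (?\<chi> j x - of_nat (dm j)) / ?\<delta> x)
        = (\<Sum>x\<in>carrier G. of_nat (dm i) * of_nat (dm j) * (?\<chi> 0 x * cnj (?\<chi> 0 x) / ?\<delta> x)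
          - of_nat (dm j) * (?\<chi> i x * cnj (?\<chi> 0 x) / ?\<delta> x)
          - of_nat (dm i) * (?\<chi> 0 x * cnj (?\<chi> j x) / ?\<delta> x)
          + ?\<chi> i x * cnj (?\<chi> j x) / ?\<delta> x)"
      by (rule sum.cong[OF refl]) (simp add: D(6) algebra_simps diff_divide_distrib add_divide_distrib)
    also have "\<dots> = of_nat (dm i) * of_nat (dm j) * S 0 0 - of_nat (dm j) * S i 0
        - of_nat (dm i) * S 0 j + S i j"
      by (simp only: sum.distrib sum_subtractf sum_distrib_left S_def)
    also have "\<dots> = of_nat (dm i) * of_nat (dm j) * (S 0 0 - S i 0 / of_nat (dm i)
        - S 0 j / of_nat (dm j) + S i j / (of_nat (dm i) * of_nat (dm j)))"
      using di dj by (simp add: field_simps)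
    finally have "b i j = 1 / ?N * (of_nat (dm i) * of_nat (dm j) * (S 0 0 - S i 0 / of_nat (dm i)
        - S 0 j / of_nat (dm j) + S i j / (of_nat (dm i) * of_nat (dm j))))"
      by (simp only: b_def)
    also have "\<dots> = ((- 1) ^ d * (- 1) ^ d) * of_nat (dm i) * of_nat (dm j) / ?N *
      (S 0 0 - S i 0 / of_nat (dm i) - S 0 j / of_nat (dm j) + S i j / (of_nat (dm i) * of_nat (dm j)))"
      by (simp add: sign)
    also have "\<dots> = (- 1) ^ d * of_nat (dm i) * of_nat (dm j) / 2 *
      (?\<eta> 0 0 - ?\<eta> i 0 / of_nat (dm i) - ?\<eta> 0 j / of_nat (dm j)
        + ?\<eta> i j / (of_nat (dm i) * of_nat (dm j)))"
      using i j by (simp add: \<eta> S_def[symmetric] algebra_simps add_divide_distrib diff_divide_distrib)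
    finally show ?thesis .
  qed
  show ?thesis
  proof (intro bexI[OF _ B] conjI ballI)
    show "inverts_mat ?E B" using EB E by (simp add: inverts_mat_def)
    show "inverts_mat B ?E" using BE B by (simp add: inverts_mat_def)
    fix i j assume "i \<in> {1..n}" "j \<in> {1..n}"
    then have ij: "i \<le> n" "j \<le> n" "B $$ (i - 1, j - 1) = b i j"
      by (auto simp: B_def)
    show "B $$ (i - 1, j - 1) = (- 1) ^ d * of_nat (dm i) * of_nat (dm j) / 2 *
        (?\<eta> 0 0 - ?\<eta> i 0 / of_nat (dm i) - ?\<eta> 0 j / of_nat (dm j)
          + ?\<eta> i j / (of_nat (dm i) * of_nat (dm j)))"
      unfolding ij(3) by (rule entry[OF ij(1,2)])
  qed
qed

end
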